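(* Let $\ell\in\mathbb{C}$. For each $0\le i\le r$, there is an automorphism $\tilde\sigma_i$ of the $(r+1)$-toroidal vertex algebra $V_{\mathcal{L}}(\ell,0)$, which extends the automorphism $\sigma_i$ of $\mathfrak{g}$ uniquely (where $\mathfrak{g}\subset V_{\mathcal{L}}(\ell,0)$).
   Context: Conventions. All vector spaces are over $\mathbb{C}$; $\mathbb{N}$ is the set of nonnegative integers; $r$ is a fixed positive integer. $\mathbf{x}=(x_1,\dots,x_r)$ (similarly $\mathbf{y},\mathbf{z}$) are commuting formal variables, $\mathbf{x}^{\mathbf{m}}=x_1^{m_1}\cdots x_r^{m_r}$ (and $\mathbf{t}^{\mathbf{m}}$ likewise) for $\mathbf{m}\in\mathbb{Z}^r$, and $\mathbf{z}\mathbf{y}=(z_1y_1,\dots,z_ry_r)$. $\delta(z)=\sum_{n\in\mathbb{Z}}z^n$, and $(x_0\pm y_0)^{n}$ is expanded in nonnegative integer powers of $y_0$. $\omega_N=\exp(2\pi\sqrt{-1}/N)$. For a vector space $W$, $\mathcal{E}(W,r)=\mathrm{Hom}\big(W,W[[x_1^{\pm1},\dots,x_r^{\pm1}]]((x_0))\big)$. Toroidal vertex algebra. An $(r+1)$-toroidal vertex algebra is a vector space $V$ with a linear map $Y(\cdot;x_0,\mathbf{x}):V\to\mathcal{E}(V,r)$, $v\mapsto Y(v;x_0,\mathbf{x})=\sum_{(m_0,\mathbf{m})\in\mathbb{Z}\times\mathbb{Z}^r}v_{m_0,\mathbf{m}}x_0^{-m_0-1}\mathbf{x}^{-\mathbf{m}}$,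 and a distinguished vector $\mathbf{1}\in V$, such that $Y(\mathbf{1};x_0,\mathbf{x})v=v$ and $Y(v;x_0,\mathbf{x})\mathbf{1}\in V[[x_0,x_1^{\pm1},\dots,x_r^{\pm1}]]$ for $v\in V$, and for $u,v\in V$ $$z_0^{-1}\delta\Big(\frac{x_0-y_0}{z_0}\Big)Y(u;x_0,\mathbf{z}\mathbf{y})Y(v;y_0,\mathbf{y})-z_0^{-1}\delta\Big(\frac{y_0-x_0}{-z_0}\Big)Y(v;y_0,\mathbf{y})Y(u;x_0,\mathbf{z}\mathbf{y})=y_0^{-1}\delta\Big(\frac{x_0-z_0}{y_0}\Big)Y(Y(u;z_0,\mathbf{z})v;y_0,\mathbf{y}).$$ An automorphism of $V$ is a linear bijection $\sigma$ with $\sigma(\mathbf{1})=\mathbf{1}$ and $\sigma(Y(u;x_0,\mathbf{x})v)=Y(\sigma(u);x_0,\mathbf{x})\sigma(v)$ for $u,v\in V$. Lie algebras. $\mathfrak{g}$ is a finite dimensional simple Lie algebra with Killing form $\langle\cdot,\cdot\rangle$ normalized so that $\langle\alpha,\alpha\rangle=2$ for long roots $\alpha$; $\sigma_0,\sigma_1,\dots,\sigma_r$ are mutually commuting automorphisms of $\mathfrak{g}$ of finite orders $N_0,N_1,\dots,N_r$. $\Lambda(\mathbf{N})=\mathbb{Z}N_1\times\cdots\times\mathbb{Z}N_r\subset\mathbb{Z}^r$. For $\mathbf{m}\in\mathbb{Z}^r$, $\mathfrak{g}_{\mathbf{m}}=\{a\in\mathfrak{g}:\sigma_i(a)=\omega_{N_i}^{m_i}a,\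 1\le i\le r\}$. $\widehat{L_{r+1}}(\mathfrak{g})=\mathfrak{g}\otimes\mathbb{C}[t_0^{\pm1},t_1^{\pm1},\dots,t_r^{\pm1}]\oplus\mathbb{C}\mathfrak{c}$ with $\mathfrak{c}$ central and $$[a\otimes t_0^{m_0}\mathbf{t}^{\mathbf{m}},b\otimes t_0^{n_0}\mathbf{t}^{\mathbf{n}}]=[a,b]\otimes t_0^{m_0+n_0}\mathbf{t}^{\mathbf{m}+\mathbf{n}}+m_0\langle a,b\rangle\delta_{m_0+n_0,0}\delta_{\mathbf{m}+\mathbf{n},0}\mathfrak{c}.$$ $\mathcal{L}$ is its subalgebra $\big(\bigoplus_{\mathbf{m}\in\mathbb{Z}^r}\mathfrak{g}_{\mathbf{m}}\otimes\mathbf{t}^{\mathbf{m}}\mathbb{C}[t_0^{\pm1}]\big)\oplus\mathbb{C}\mathfrak{c}$, and $\mathcal{L}^{\ge0}=\big(\bigoplus_{\mathbf{m}}\mathfrak{g}_{\mathbf{m}}\otimes\mathbf{t}^{\mathbf{m}}\mathbb{C}[t_0]\big)\oplus\mathbb{C}\mathfrak{c}$. For $a\in\mathfrak{g}_{\mathbf{k}}$ put $a^{\mathcal{L}}(x_0,\mathbf{x})=\sum_{m_0\in\mathbb{Z},\ \mathbf{m}\in\mathbf{k}+\Lambda(\mathbf{N})}(a\otimes t_0^{m_0}\mathbf{t}^{\mathbf{m}})x_0^{-m_0-1}\mathbf{x}^{-\mathbf{m}}$, extended linearly to $a\in\mathfrak{g}$. The algebra $V_{\mathcal{L}}(\ell,0)$.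 $(\mathfrak{g}\oplus\mathbb{C})_\ell$ is the $\mathcal{L}^{\ge0}$-module $\mathfrak{g}\oplus\mathbb{C}$ on which $\mathfrak{c}$ acts as $\ell$ and, for $a\in\mathfrak{g}_{\mathbf{k}}$, $b\in\mathfrak{g}$, $j\in\mathbb{N}$, $\mathbf{m}\in\mathbf{k}+\Lambda(\mathbf{N})$: $(a\otimes t_0^j\mathbf{t}^{\mathbf{m}})\cdot\mathbb{C}=0$, and $(a\otimes t_0^j\mathbf{t}^{\mathbf{m}})\cdot b$ equals $[a,b]$ if $j=0$, $\langle a,b\rangle\ell$ if $j=1$, $0$ if $j\ge2$. $V_{\mathcal{L}}(\ell,0)=U(\mathcal{L})\otimes_{U(\mathcal{L}^{\ge0})}(\mathfrak{g}\oplus\mathbb{C})_\ell$, $\mathbf{1}=1\otimes1$, and $\mathfrak{g}$ is identified with $1\otimes\mathfrak{g}$. $V_{\mathcal{L}}(\ell,0)$ is equipped with its unique $(r+1)$-toroidal vertex algebra structure with vacuum vector $\mathbf{1}$ and $Y(a;x_0,\mathbf{x})=a^{\mathcal{L}}(x_0,\mathbf{x})$ for $a\in\mathfrak{g}$. *)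

theory Defs
  imports
    "HOL-Analysis.Finite_Cartesian_Product"
    "HOL-Library.Poly_Mapping"
    "HOL-Library.Product_Plus"
    "HOL-Algebra.Algebraic_Closure_Type"
    "HOL-Algebra.Bij"
begin

section \<open>Finite-dimensional simple Lie algebras\<close>

locale lie_algebra = vector_space sc
  for sc :: "complex \<Rightarrow> 'g::ab_group_add \<Rightarrow> 'g" +
  fixes br :: "'g \<Rightarrow> 'g \<Rightarrow> 'g"
  assumes br_linear_left: "Vector_Spaces.linear sc sc (\<lambda>x. br x y)"
    and br_linear_right: "Vector_Spaces.linear sc sc (br x)"
    and br_self: "br x x = 0"
    and br_jacobi: "br x (br y z) + br y (br z x) + br z (br x y) = 0"

locale fd_simple_lie_algebra = lie_algebra +
  assumes finite_dim: "\<exists>B. finite_dimensional_vector_space sc B"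
    and nonabelian: "\<exists>x y. br x y \<noteq> 0"
    and no_proper_ideal: "\<lbrakk>subspace I; \<And>x y. y \<in> I \<Longrightarrow> br x y \<in> I\<rbrakk> \<Longrightarrow> I = {0} \<or> I = UNIV"

definition lie_automorphism ::
  "(complex \<Rightarrow> 'g::ab_group_add \<Rightarrow> 'g) \<Rightarrow> ('g \<Rightarrow> 'g \<Rightarrow> 'g) \<Rightarrow> ('g \<Rightarrow> 'g) \<Rightarrow> bool" where
  "lie_automorphism sc br \<sigma> \<longleftrightarrow>
     Vector_Spaces.linear sc sc \<sigma> \<and> bij \<sigma> \<and> (\<forall>x y. \<sigma> (br x y) = br (\<sigma> x) (\<sigma> y))"

definition has_order :: "('a \<Rightarrow> 'a) \<Rightarrow> nat \<Rightarrow> bool" where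
  "has_order f n \<longleftrightarrow> n > 0 \<and> f ^^ n = id \<and> (\<forall>k. 0 < k \<and> k < n \<longrightarrow> f ^^ k \<noteq> id)"

subsection \<open>The normalized Killing form\<close>

definition lin_trace ::
  "(complex \<Rightarrow> 'g::ab_group_add \<Rightarrow> 'g) \<Rightarrow> ('g \<Rightarrow> 'g) \<Rightarrow> complex" where
  "lin_trace sc f =
     (let B = (SOME B. finite_dimensional_vector_space sc B)
      in \<Sum>b\<in>B. module.representation sc B (f b) b)"

definition killing_form ::
  "(complex \<Rightarrow> 'g::ab_group_add \<Rightarrow> 'g) \<Rightarrow> ('g \<Rightarrow> 'g \<Rightarrow> 'g) \<Rightarrow> 'g \<Rightarrow> 'g \<Rightarrow> complex" where
  "killing_form sc br x y = lin_trace sc (br x \<circ> br y)"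

definition toral_subalgebra ::
  "(complex \<Rightarrow> 'g::ab_group_add \<Rightarrow> 'g) \<Rightarrow> ('g \<Rightarrow> 'g \<Rightarrow> 'g) \<Rightarrow> 'g set \<Rightarrow> bool" where
  "toral_subalgebra sc br H \<longleftrightarrow>
     module.subspace sc H \<and> (\<forall>x\<in>H. \<forall>y\<in>H. br x y \<in> H) \<and>
     (\<forall>h\<in>H. module.span sc {x. \<exists>c. br h x = sc c x} = UNIV)"

text \<open>Over \<open>\<complex>\<close> the Cartan subalgebras of a semisimple Lie algebra are its maximal toral
  subalgebras.\<close>

definition cartan_subalgebra ::
  "(complex \<Rightarrow> 'g::ab_group_add \<Rightarrow> 'g) \<Rightarrow> ('g \<Rightarrow> 'g \<Rightarrow> 'g) \<Rightarrow> 'g set \<Rightarrow> bool" where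
  "cartan_subalgebra sc br H \<longleftrightarrow>
     toral_subalgebra sc br H \<and>
     (\<forall>K. toral_subalgebra sc br K \<and> H \<subseteq> K \<longrightarrow> K = H)"

text \<open>A functional on \<open>H\<close> is given by a function on the whole type; only its values on \<open>H\<close>
  matter, and these are linear as soon as the root space is nonzero.\<close>

definition is_root ::
  "(complex \<Rightarrow> 'g::ab_group_add \<Rightarrow> 'g) \<Rightarrow> ('g \<Rightarrow> 'g \<Rightarrow> 'g) \<Rightarrow> 'g set \<Rightarrow> ('g \<Rightarrow> complex) \<Rightarrow> bool" where
  "is_root sc br H \<alpha> \<longleftrightarrow>
     (\<exists>h\<in>H. \<alpha> h \<noteq> 0) \<and> (\<exists>x. x \<noteq> 0 \<and> (\<forall>h\<in>H. br h x = sc (\<alpha> h) x))"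

text \<open>The value \<open>\<langle>\<alpha>, \<alpha>\<rangle>\<close> of the form on the dual of \<open>H\<close> that \<open>\<langle>\<cdot>, \<cdot>\<rangle>\<close> induces, i.e.
  \<open>\<langle>t, t\<rangle>\<close> for the element \<open>t\<close> of \<open>H\<close> that represents \<open>\<alpha>\<close>.\<close>

definition dual_norm ::
  "('g \<Rightarrow> 'g \<Rightarrow> complex) \<Rightarrow> 'g set \<Rightarrow> ('g \<Rightarrow> complex) \<Rightarrow> complex" where
  "dual_norm form H \<alpha> =
     (let t = (THE t. t \<in> H \<and> (\<forall>h\<in>H. form t h = \<alpha> h)) in form t t)"

text \<open>Lengths are compared by means of the Killing form, for which all \<open>\<langle>\<alpha>, \<alpha>\<rangle>\<close> are positive
  reals.\<close>

definition is_long_root ::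
  "(complex \<Rightarrow> 'g::ab_group_add \<Rightarrow> 'g) \<Rightarrow> ('g \<Rightarrow> 'g \<Rightarrow> 'g) \<Rightarrow> 'g set \<Rightarrow> ('g \<Rightarrow> complex) \<Rightarrow> bool" where
  "is_long_root sc br H \<alpha> \<longleftrightarrow>
     is_root sc br H \<alpha> \<and>
     (\<forall>\<beta>. is_root sc br H \<beta> \<longrightarrow>
        Re (dual_norm (killing_form sc br) H \<beta>) \<le> Re (dual_norm (killing_form sc br) H \<alpha>))"

definition normalized_killing_form ::
  "(complex \<Rightarrow> 'g::ab_group_add \<Rightarrow> 'g) \<Rightarrow> ('g \<Rightarrow> 'g \<Rightarrow> 'g) \<Rightarrow> ('g \<Rightarrow> 'g \<Rightarrow> complex) \<Rightarrow> bool" where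
  "normalized_killing_form sc br form \<longleftrightarrow>
     (\<exists>c. c \<noteq> 0 \<and> (\<forall>x y. form x y = c * killing_form sc br x y)) \<and>
     (\<forall>H \<alpha>. cartan_subalgebra sc br H \<and> is_long_root sc br H \<alpha> \<longrightarrow> dual_norm form H \<alpha> = 2)"

section \<open>Toroidal vertex algebras\<close>

abbreviation complex_ring :: "complex ring" where
  "complex_ring \<equiv> ring_of_type_algebra"

text \<open>Coefficient of \<open>a\<^sup>i b\<^sup>j\<close> in \<open>(a - b)\<^sup>n\<close>, expanded in nonnegative powers of \<open>b\<close>.\<close>

definition binom_coeff :: "int \<Rightarrow> int \<Rightarrow> int \<Rightarrow> complex" where
  "binom_coeff n i j =
     (if 0 \<le> j \<and> i + j = n then (- 1) ^ nat j * (of_int n gchoose nat j) else 0)"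

text \<open>Coefficients of \<open>z\<^sub>0\<^sup>h x\<^sub>0\<^sup>i y\<^sub>0\<^sup>j\<close> in the three delta functions of the Jacobi identity:
  \<open>z\<^sub>0\<^sup>-\<^sup>1 \<delta>((x\<^sub>0 - y\<^sub>0) / z\<^sub>0)\<close>, \<open>z\<^sub>0\<^sup>-\<^sup>1 \<delta>((y\<^sub>0 - x\<^sub>0) / (- z\<^sub>0))\<close>
  and \<open>y\<^sub>0\<^sup>-\<^sup>1 \<delta>((x\<^sub>0 - z\<^sub>0) / y\<^sub>0)\<close>. In the first two, \<open>h = - n - 1\<close> for the
  summation index \<open>n\<close> of \<open>\<delta>\<close>; in the third, \<open>j = - n - 1\<close>.\<close>

definition delta_xy :: "int \<Rightarrow> int \<Rightarrow> int \<Rightarrow> complex" where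
  "delta_xy h i j = binom_coeff (- h - 1) i j"

definition delta_yx :: "int \<Rightarrow> int \<Rightarrow> int \<Rightarrow> complex" where
  "delta_yx h i j = (- 1) powi (- h - 1) * binom_coeff (- h - 1) j i"

definition delta_xz :: "int \<Rightarrow> int \<Rightarrow> int \<Rightarrow> complex" where
  "delta_xz h i j = binom_coeff (- j - 1) i h"

text \<open>Sum of a family with finite support.\<close>

definition supp_sum :: "('a, 'v, 'b) module_scheme \<Rightarrow> ('i \<Rightarrow> 'v) \<Rightarrow> 'v" where
  "supp_sum V f = finsum V f {i. f i \<noteq> \<zero>\<^bsub>V\<^esub>}"

definition linear_endo :: "(complex, 'v, 'b) module_scheme \<Rightarrow> ('v \<Rightarrow> 'v) \<Rightarrow> bool" where
  "linear_endo V f \<longleftrightarrow>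
     f \<in> carrier V \<rightarrow> carrier V \<and>
     (\<forall>v\<in>carrier V. \<forall>w\<in>carrier V. f (v \<oplus>\<^bsub>V\<^esub> w) = f v \<oplus>\<^bsub>V\<^esub> f w) \<and>
     (\<forall>c. \<forall>v\<in>carrier V. f (c \<odot>\<^bsub>V\<^esub> v) = c \<odot>\<^bsub>V\<^esub> f v)"

text \<open>\<open>Y v m0 m\<close> is the mode of \<open>v\<close> that is the coefficient of
  \<open>x\<^sub>0^(- m0 - 1) x^(- m)\<close> in \<open>Y(v; x\<^sub>0, x)\<close>. In \<open>truncation\<close> the bound \<open>K\<close> is uniform in \<open>m\<close>,
  since \<open>Y(u; x\<^sub>0, x) v\<close> is a Laurent series in \<open>x\<^sub>0\<close> with coefficients in
  \<open>V[[x\<^sub>1\<^sup>\<plusminus>\<^sup>1, \<dots>, x\<^sub>r\<^sup>\<plusminus>\<^sup>1]]\<close>. The axiom \<open>jacobi\<close> compares the coefficients of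
  \<open>z\<^sub>0^a x\<^sub>0^b y\<^sub>0^c z^(- m) y^(- p)\<close>, each being a sum over the ways to split the exponents of
  \<open>x\<^sub>0, y\<^sub>0\<close> (on the right: of \<open>z\<^sub>0, y\<^sub>0\<close>) between the delta function and the product of fields;
  by \<open>truncation\<close> these sums have finite support. As \<open>Y(u; x\<^sub>0, z y)\<close> contributes
  \<open>z^(- m) y^(- m)\<close>, the mode of \<open>v\<close> on the left has index \<open>p - m\<close>.\<close>

locale toroidal_vertex_algebra = module complex_ring V
  for V :: "(complex, 'v, 'b) module_scheme" (structure) +
  fixes Y :: "'v \<Rightarrow> int \<Rightarrow> int ^ 'r::finite \<Rightarrow> 'v \<Rightarrow> 'v"
    and vac :: 'v
  assumes vac_closed: "vac \<in> carrier V"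
    and linear_right: "v \<in> carrier V \<Longrightarrow> linear_endo V (Y v m0 m)"
    and linear_left: "w \<in> carrier V \<Longrightarrow> linear_endo V (\<lambda>v. Y v m0 m w)"
    and truncation: "\<lbrakk>u \<in> carrier V; v \<in> carrier V\<rbrakk> \<Longrightarrow> \<exists>K. \<forall>m0\<ge>K. \<forall>m. Y u m0 m v = \<zero>"
    and vacuum: "v \<in> carrier V \<Longrightarrow> Y vac m0 m v = (if m0 = - 1 \<and> m = 0 then v else \<zero>)"
    and creation: "\<lbrakk>v \<in> carrier V; 0 \<le> m0\<rbrakk> \<Longrightarrow> Y v m0 m vac = \<zero>"
    and jacobi: "\<lbrakk>u \<in> carrier V; v \<in> carrier V; w \<in> carrier V\<rbrakk> \<Longrightarrow>
       supp_sum V (\<lambda>(i, j). delta_xy a i j \<odot> Y u (- (b - i) - 1) m (Y v (- (c - j) - 1) (p - m) w))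
       \<ominus> supp_sum V (\<lambda>(i, j). delta_yx a i j \<odot> Y v (- (c - j) - 1) (p - m) (Y u (- (b - i) - 1) m w))
       = supp_sum V (\<lambda>(h, j). delta_xz h b j \<odot> Y (Y u (- (a - h) - 1) m v) (- (c - j) - 1) p w)"

text \<open>\<^const>\<open>Bij\<close> makes the functions extensional, so that equality of automorphisms is equality
  on the carrier.\<close>

definition toroidal_va_automorphism ::
  "(complex, 'v, 'b) module_scheme \<Rightarrow> ('v \<Rightarrow> int \<Rightarrow> int ^ 'r \<Rightarrow> 'v \<Rightarrow> 'v) \<Rightarrow> 'v \<Rightarrow> ('v \<Rightarrow> 'v) \<Rightarrow> bool" where
  "toroidal_va_automorphism V Y vac \<tau> \<longleftrightarrow>
     \<tau> \<in> Bij (carrier V) \<and> linear_endo V \<tau> \<and> \<tau> vac = vac \<and>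
     (\<forall>u\<in>carrier V. \<forall>v\<in>carrier V. \<forall>m0 m. \<tau> (Y u m0 m v) = Y (\<tau> u) m0 m (\<tau> v))"

section \<open>Enveloping algebras and induced modules\<close>

subsection \<open>Free algebras\<close>

text \<open>Words form the free monoid, written additively so that the convolution product of
  \<^typ>\<open>'a \<Rightarrow>\<^sub>0 'b\<close> makes finitely supported functions on words the free algebra.\<close>

datatype 'l free_word = Free_Word (letters: "'l list")

instantiation free_word :: (type) monoid_add
begin

definition zero_free_word :: "'a free_word" where
  "zero_free_word = Free_Word []"

definition plus_free_word :: "'a free_word \<Rightarrow> 'a free_word \<Rightarrow> 'a free_word" where
  "plus_free_word v w = Free_Word (letters v @ letters w)"

instance
  by standard (auto simp: zero_free_word_def plus_free_word_def)

end

type_synonym 'l free_alg = "'l free_word \<Rightarrow>\<^sub>0 complex"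

definition fscale :: "complex \<Rightarrow> ('s \<Rightarrow>\<^sub>0 complex) \<Rightarrow> 's \<Rightarrow>\<^sub>0 complex" where
  "fscale c f = Poly_Mapping.map ((*) c) f"

definition lin_ext ::
  "(complex \<Rightarrow> 'w \<Rightarrow> 'w::ab_group_add) \<Rightarrow> ('s \<Rightarrow> 'w) \<Rightarrow> ('s \<Rightarrow>\<^sub>0 complex) \<Rightarrow> 'w" where
  "lin_ext sc \<phi> f = (\<Sum>s\<in>Poly_Mapping.keys f. sc (Poly_Mapping.lookup f s) (\<phi> s))"

definition gen :: "'l \<Rightarrow> 'l free_alg" where
  "gen x = Poly_Mapping.single (Free_Word [x]) 1"

definition free_alg_ring :: "'l set \<Rightarrow> 'l free_alg ring" where
  "free_alg_ring L =
     ring_of_type_algebra\<lparr>carrier := {f. \<forall>w\<in>Poly_Mapping.keys f. set (letters w) \<subseteq> L}\<rparr>"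

subsection \<open>Universal enveloping algebras\<close>

text \<open>Below, \<open>L\<close> is a Lie subalgebra of a Lie algebra given by \<open>sc\<close> and \<open>br\<close> on a type.\<close>

definition uea_rels ::
  "(complex \<Rightarrow> 'l::ab_group_add \<Rightarrow> 'l) \<Rightarrow> ('l \<Rightarrow> 'l \<Rightarrow> 'l) \<Rightarrow> 'l set \<Rightarrow> 'l free_alg set" where
  "uea_rels sc br L =
     {gen (x + y) - gen x - gen y | x y. x \<in> L \<and> y \<in> L} \<union>
     {gen (sc c x) - fscale c (gen x) | c x. x \<in> L} \<union>
     {gen x * gen y - gen y * gen x - gen (br x y) | x y. x \<in> L \<and> y \<in> L}"

definition uea_ideal ::
  "(complex \<Rightarrow> 'l::ab_group_add \<Rightarrow> 'l) \<Rightarrow> ('l \<Rightarrow> 'l \<Rightarrow> 'l) \<Rightarrow> 'l set \<Rightarrow> 'l free_alg set" where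
  "uea_ideal sc br L = Idl\<^bsub>free_alg_ring L\<^esub> (uea_rels sc br L)"

definition uea ::
  "(complex \<Rightarrow> 'l::ab_group_add \<Rightarrow> 'l) \<Rightarrow> ('l \<Rightarrow> 'l \<Rightarrow> 'l) \<Rightarrow> 'l set \<Rightarrow> 'l free_alg set ring" where
  "uea sc br L = free_alg_ring L Quot uea_ideal sc br L"

definition uea_class ::
  "(complex \<Rightarrow> 'l::ab_group_add \<Rightarrow> 'l) \<Rightarrow> ('l \<Rightarrow> 'l \<Rightarrow> 'l) \<Rightarrow> 'l set \<Rightarrow> 'l free_alg \<Rightarrow> 'l free_alg set" where
  "uea_class sc br L f = uea_ideal sc br L +>\<^bsub>free_alg_ring L\<^esub> f"

subsection \<open>Quotients of vector spaces\<close>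

definition vs_coset :: "'f::ab_group_add set \<Rightarrow> 'f \<Rightarrow> 'f set" where
  "vs_coset R f = {f + h | h. h \<in> R}"

definition coset_lift :: "'f::ab_group_add set \<Rightarrow> ('f \<Rightarrow> 'f) \<Rightarrow> 'f set \<Rightarrow> 'f set" where
  "coset_lift R \<phi> A = (\<Union>f\<in>A. vs_coset R (\<phi> f))"

text \<open>The fields \<open>mult\<close> and \<open>one\<close> of the record play no role for a module.\<close>

definition quotient_space ::
  "(complex \<Rightarrow> 'f::ab_group_add \<Rightarrow> 'f) \<Rightarrow> 'f set \<Rightarrow> 'f set \<Rightarrow> (complex, 'f set) module" where
  "quotient_space sc F R =
     \<lparr>carrier = vs_coset R ` F,
      monoid.mult = undefined,
      one = undefined,
      zero = R,
      add = (\<lambda>A B. \<Union>f\<in>A. \<Union>g\<in>B. vs_coset R (f + g)),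
      module.smult = (\<lambda>c. coset_lift R (sc c))\<rparr>"

subsection \<open>Induced modules\<close>

text \<open>The action on a module \<open>M\<close> of the element of the enveloping algebra of \<open>P\<close> represented by
  an element of the free algebra on \<open>P\<close>, where \<open>\<rho>\<close> is the action of \<open>P\<close>.\<close>

definition free_alg_act ::
  "(complex \<Rightarrow> 'm \<Rightarrow> 'm::ab_group_add) \<Rightarrow> ('l \<Rightarrow> 'm \<Rightarrow> 'm) \<Rightarrow> 'l free_alg \<Rightarrow> 'm \<Rightarrow> 'm" where
  "free_alg_act scaleM \<rho> f m = lin_ext scaleM (\<lambda>w. foldr \<rho> (letters w) m) f"

type_synonym ('l, 'm) pre_tensor = "('l free_alg set \<times> 'm) \<Rightarrow>\<^sub>0 complex"

abbreviation pure_tensor :: "'l free_alg set \<Rightarrow> 'm \<Rightarrow> ('l, 'm) pre_tensor" where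
  "pure_tensor u m \<equiv> Poly_Mapping.single (u, m) 1"

text \<open>\<open>U(L) \<otimes>\<^bsub>U(P)\<^esub> M\<close> is the quotient of the free vector space on \<open>U(L) \<times> M\<close> by the span of the
  following relations, where \<open>M\<close> is a \<open>P\<close>-module on a whole type. In the last relation \<open>f\<close>
  represents an arbitrary element of \<open>U(P)\<close>.\<close>

definition tensor_rels ::
  "(complex \<Rightarrow> 'l::ab_group_add \<Rightarrow> 'l) \<Rightarrow> ('l \<Rightarrow> 'l \<Rightarrow> 'l) \<Rightarrow> 'l set \<Rightarrow> 'l set \<Rightarrow>
   (complex \<Rightarrow> 'm::ab_group_add \<Rightarrow> 'm) \<Rightarrow> ('l \<Rightarrow> 'm \<Rightarrow> 'm) \<Rightarrow> ('l, 'm) pre_tensor set" where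
  "tensor_rels sc br L P scaleM \<rho> =
     (let U = uea sc br L; cls = uea_class sc br L in
      {pure_tensor (u \<oplus>\<^bsub>U\<^esub> u') m - pure_tensor u m - pure_tensor u' m
        | u u' m. u \<in> carrier U \<and> u' \<in> carrier U} \<union>
      {pure_tensor u (m + m') - pure_tensor u m - pure_tensor u m'
        | u m m'. u \<in> carrier U} \<union>
      {pure_tensor (cls (fscale c 1) \<otimes>\<^bsub>U\<^esub> u) m - fscale c (pure_tensor u m)
        | c u m. u \<in> carrier U} \<union>
      {pure_tensor u (scaleM c m) - fscale c (pure_tensor u m)
        | c u m. u \<in> carrier U} \<union>
      {pure_tensor (u \<otimes>\<^bsub>U\<^esub> cls f) m - pure_tensor u (free_alg_act scaleM \<rho> f m)
        | u f m. u \<in> carrier U \<and> f \<in> carrier (free_alg_ring P)})"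

definition tensor_ker ::
  "(complex \<Rightarrow> 'l::ab_group_add \<Rightarrow> 'l) \<Rightarrow> ('l \<Rightarrow> 'l \<Rightarrow> 'l) \<Rightarrow> 'l set \<Rightarrow> 'l set \<Rightarrow>
   (complex \<Rightarrow> 'm::ab_group_add \<Rightarrow> 'm) \<Rightarrow> ('l \<Rightarrow> 'm \<Rightarrow> 'm) \<Rightarrow> ('l, 'm) pre_tensor set" where
  "tensor_ker sc br L P scaleM \<rho> = module.span fscale (tensor_rels sc br L P scaleM \<rho>)"

definition induced_module ::
  "(complex \<Rightarrow> 'l::ab_group_add \<Rightarrow> 'l) \<Rightarrow> ('l \<Rightarrow> 'l \<Rightarrow> 'l) \<Rightarrow> 'l set \<Rightarrow> 'l set \<Rightarrow>
   (complex \<Rightarrow> 'm::ab_group_add \<Rightarrow> 'm) \<Rightarrow> ('l \<Rightarrow> 'm \<Rightarrow> 'm) \<Rightarrow>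
   (complex, ('l, 'm) pre_tensor set) module" where
  "induced_module sc br L P scaleM \<rho> =
     quotient_space fscale {f. fst ` Poly_Mapping.keys f \<subseteq> carrier (uea sc br L)}
       (tensor_ker sc br L P scaleM \<rho>)"

text \<open>The class \<open>1 \<otimes> m\<close>.\<close>

definition induced_emb ::
  "(complex \<Rightarrow> 'l::ab_group_add \<Rightarrow> 'l) \<Rightarrow> ('l \<Rightarrow> 'l \<Rightarrow> 'l) \<Rightarrow> 'l set \<Rightarrow> 'l set \<Rightarrow>
   (complex \<Rightarrow> 'm::ab_group_add \<Rightarrow> 'm) \<Rightarrow> ('l \<Rightarrow> 'm \<Rightarrow> 'm) \<Rightarrow> 'm \<Rightarrow> ('l, 'm) pre_tensor set" where
  "induced_emb sc br L P scaleM \<rho> m =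
     vs_coset (tensor_ker sc br L P scaleM \<rho>) (pure_tensor \<one>\<^bsub>uea sc br L\<^esub> m)"

text \<open>The action \<open>x \<cdot> (u \<otimes> m) = (x u) \<otimes> m\<close> of \<open>x \<in> L\<close>.\<close>

definition induced_act ::
  "(complex \<Rightarrow> 'l::ab_group_add \<Rightarrow> 'l) \<Rightarrow> ('l \<Rightarrow> 'l \<Rightarrow> 'l) \<Rightarrow> 'l set \<Rightarrow> 'l set \<Rightarrow>
   (complex \<Rightarrow> 'm::ab_group_add \<Rightarrow> 'm) \<Rightarrow> ('l \<Rightarrow> 'm \<Rightarrow> 'm) \<Rightarrow> 'l \<Rightarrow>
   ('l, 'm) pre_tensor set \<Rightarrow> ('l, 'm) pre_tensor set" where
  "induced_act sc br L P scaleM \<rho> x =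
     coset_lift (tensor_ker sc br L P scaleM \<rho>)
       (lin_ext fscale
         (\<lambda>(u, m). pure_tensor (uea_class sc br L (gen x) \<otimes>\<^bsub>uea sc br L\<^esub> u) m))"

section \<open>The toroidal Lie algebra\<close>

text \<open>An element \<open>(f, s)\<close> stands for the sum \<open>\<Sum> f (m0, m) \<otimes> t\<^sub>0^m0 t^m + s c\<close>.\<close>

type_synonym ('g, 'r) toroidal = "((int \<times> (int ^ 'r)) \<Rightarrow>\<^sub>0 'g) \<times> complex"

definition tor_scale ::
  "(complex \<Rightarrow> 'g::ab_group_add \<Rightarrow> 'g) \<Rightarrow> complex \<Rightarrow> ('g, 'r::finite) toroidal \<Rightarrow> ('g, 'r) toroidal" where
  "tor_scale sc c x = (Poly_Mapping.map (sc c) (fst x), c * snd x)"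

definition tor_br ::
  "('g \<Rightarrow> 'g \<Rightarrow> 'g::ab_group_add) \<Rightarrow> ('g \<Rightarrow> 'g \<Rightarrow> complex) \<Rightarrow>
   ('g, 'r::finite) toroidal \<Rightarrow> ('g, 'r) toroidal \<Rightarrow> ('g, 'r) toroidal" where
  "tor_br br form x y =
     (\<Sum>p\<in>Poly_Mapping.keys (fst x). \<Sum>q\<in>Poly_Mapping.keys (fst y).
        let a = Poly_Mapping.lookup (fst x) p; b = Poly_Mapping.lookup (fst y) q in
        (Poly_Mapping.single (p + q) (br a b),
         if p + q = 0 then of_int (fst p) * form a b else 0))"

text \<open>The index type \<^typ>\<open>'r option\<close> stands for \<open>{0, 1, \<dots>, r}\<close>, with \<^const>\<open>None\<close> in the
  role of \<open>0\<close>.\<close>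

definition grade_space ::
  "(complex \<Rightarrow> 'g::ab_group_add \<Rightarrow> 'g) \<Rightarrow> ('r::finite option \<Rightarrow> 'g \<Rightarrow> 'g) \<Rightarrow> ('r option \<Rightarrow> nat) \<Rightarrow>
   int ^ 'r \<Rightarrow> 'g set" where
  "grade_space sc \<sigma> N m =
     {a. \<forall>i. \<sigma> (Some i) a = sc (exp (2 * of_real pi * \<i> / of_nat (N (Some i))) powi (m $ i)) a}"

definition LL ::
  "(complex \<Rightarrow> 'g::ab_group_add \<Rightarrow> 'g) \<Rightarrow> ('r::finite option \<Rightarrow> 'g \<Rightarrow> 'g) \<Rightarrow> ('r option \<Rightarrow> nat) \<Rightarrow>
   ('g, 'r) toroidal set" where
  "LL sc \<sigma> N = {(f, s). \<forall>m0 m. Poly_Mapping.lookup f (m0, m) \<in> grade_space sc \<sigma> N m}"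

definition LL_nonneg ::
  "(complex \<Rightarrow> 'g::ab_group_add \<Rightarrow> 'g) \<Rightarrow> ('r::finite option \<Rightarrow> 'g \<Rightarrow> 'g) \<Rightarrow> ('r option \<Rightarrow> nat) \<Rightarrow>
   ('g, 'r) toroidal set" where
  "LL_nonneg sc \<sigma> N =
     {(f, s) \<in> LL sc \<sigma> N. \<forall>m0 m. m0 < 0 \<longrightarrow> Poly_Mapping.lookup f (m0, m) = 0}"

text \<open>For \<open>a\<close> in the graded piece of degree \<open>k\<close>, the coefficient of
  \<open>x\<^sub>0^(- m0 - 1) x^(- m)\<close> in the generating function of \<open>a\<close> with values in \<^const>\<open>LL\<close>.\<close>

definition current_coeff ::
  "('r::finite option \<Rightarrow> nat) \<Rightarrow> int ^ 'r \<Rightarrow> 'g::ab_group_add \<Rightarrow> int \<Rightarrow> int ^ 'r \<Rightarrow> ('g, 'r) toroidal" where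
  "current_coeff N k a m0 m =
     (if \<forall>i. int (N (Some i)) dvd (m - k) $ i then (Poly_Mapping.single (m0, m) a, 0) else 0)"

subsection \<open>The module \<open>(\<gg> \<oplus> \<complex>)\<^sub>\<ell>\<close>\<close>

definition gC_scale ::
  "(complex \<Rightarrow> 'g \<Rightarrow> 'g) \<Rightarrow> complex \<Rightarrow> 'g \<times> complex \<Rightarrow> 'g \<times> complex" where
  "gC_scale sc c m = (sc c (fst m), c * snd m)"

definition gC_act ::
  "(complex \<Rightarrow> 'g::ab_group_add \<Rightarrow> 'g) \<Rightarrow> ('g \<Rightarrow> 'g \<Rightarrow> 'g) \<Rightarrow> ('g \<Rightarrow> 'g \<Rightarrow> complex) \<Rightarrow> complex \<Rightarrow>
   ('g, 'r::finite) toroidal \<Rightarrow> 'g \<times> complex \<Rightarrow> 'g \<times> complex" where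
  "gC_act sc br form l x = (\<lambda>(b, z).
     (\<Sum>(j, m)\<in>Poly_Mapping.keys (fst x).
        let a = Poly_Mapping.lookup (fst x) (j, m) in
        if j = 0 then (br a b, 0) else if j = 1 then (0, form a b * l) else (0, 0))
     + gC_scale sc (snd x * l) (b, z))"

section \<open>The algebra \<open>V\<^sub>L(\<ell>, 0)\<close>\<close>

definition VL ::
  "(complex \<Rightarrow> 'g::ab_group_add \<Rightarrow> 'g) \<Rightarrow> ('g \<Rightarrow> 'g \<Rightarrow> 'g) \<Rightarrow> ('g \<Rightarrow> 'g \<Rightarrow> complex) \<Rightarrow>
   ('r::finite option \<Rightarrow> 'g \<Rightarrow> 'g) \<Rightarrow> ('r option \<Rightarrow> nat) \<Rightarrow> complex \<Rightarrow>
   (complex, (('g, 'r) toroidal, 'g \<times> complex) pre_tensor set) module" where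
  "VL sc br form \<sigma> N l =
     induced_module (tor_scale sc) (tor_br br form) (LL sc \<sigma> N) (LL_nonneg sc \<sigma> N)
       (gC_scale sc) (gC_act sc br form l)"

definition VL_act ::
  "(complex \<Rightarrow> 'g::ab_group_add \<Rightarrow> 'g) \<Rightarrow> ('g \<Rightarrow> 'g \<Rightarrow> 'g) \<Rightarrow> ('g \<Rightarrow> 'g \<Rightarrow> complex) \<Rightarrow>
   ('r::finite option \<Rightarrow> 'g \<Rightarrow> 'g) \<Rightarrow> ('r option \<Rightarrow> nat) \<Rightarrow> complex \<Rightarrow> ('g, 'r) toroidal \<Rightarrow>
   (('g, 'r) toroidal, 'g \<times> complex) pre_tensor set \<Rightarrow>
   (('g, 'r) toroidal, 'g \<times> complex) pre_tensor set" where
  "VL_act sc br form \<sigma> N l =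
     induced_act (tor_scale sc) (tor_br br form) (LL sc \<sigma> N) (LL_nonneg sc \<sigma> N)
       (gC_scale sc) (gC_act sc br form l)"

definition VL_emb ::
  "(complex \<Rightarrow> 'g::ab_group_add \<Rightarrow> 'g) \<Rightarrow> ('g \<Rightarrow> 'g \<Rightarrow> 'g) \<Rightarrow> ('g \<Rightarrow> 'g \<Rightarrow> complex) \<Rightarrow>
   ('r::finite option \<Rightarrow> 'g \<Rightarrow> 'g) \<Rightarrow> ('r option \<Rightarrow> nat) \<Rightarrow> complex \<Rightarrow> 'g \<times> complex \<Rightarrow>
   (('g, 'r) toroidal, 'g \<times> complex) pre_tensor set" where
  "VL_emb sc br form \<sigma> N l =
     induced_emb (tor_scale sc) (tor_br br form) (LL sc \<sigma> N) (LL_nonneg sc \<sigma> N)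
       (gC_scale sc) (gC_act sc br form l)"

definition VL_vac ::
  "(complex \<Rightarrow> 'g::ab_group_add \<Rightarrow> 'g) \<Rightarrow> ('g \<Rightarrow> 'g \<Rightarrow> 'g) \<Rightarrow> ('g \<Rightarrow> 'g \<Rightarrow> complex) \<Rightarrow>
   ('r::finite option \<Rightarrow> 'g \<Rightarrow> 'g) \<Rightarrow> ('r option \<Rightarrow> nat) \<Rightarrow> complex \<Rightarrow>
   (('g, 'r) toroidal, 'g \<times> complex) pre_tensor set" where
  "VL_vac sc br form \<sigma> N l = VL_emb sc br form \<sigma> N l (0, 1)"

definition VL_inc ::
  "(complex \<Rightarrow> 'g::ab_group_add \<Rightarrow> 'g) \<Rightarrow> ('g \<Rightarrow> 'g \<Rightarrow> 'g) \<Rightarrow> ('g \<Rightarrow> 'g \<Rightarrow> complex) \<Rightarrow>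
   ('r::finite option \<Rightarrow> 'g \<Rightarrow> 'g) \<Rightarrow> ('r option \<Rightarrow> nat) \<Rightarrow> complex \<Rightarrow> 'g \<Rightarrow>
   (('g, 'r) toroidal, 'g \<times> complex) pre_tensor set" where
  "VL_inc sc br form \<sigma> N l a = VL_emb sc br form \<sigma> N l (a, 0)"

text \<open>\<open>Y\<close> is a toroidal vertex algebra structure on \<open>V\<^sub>L(\<ell>, 0)\<close> under which each \<open>a \<in> \<gg>\<close> is sent
  to its generating function. It suffices to say so for homogeneous \<open>a\<close>, since these span \<open>\<gg>\<close>
  and both sides are linear in \<open>a\<close>. There is exactly one such \<open>Y\<close> on the carrier.\<close>

definition is_VL_structure ::
  "(complex \<Rightarrow> 'g::ab_group_add \<Rightarrow> 'g) \<Rightarrow> ('g \<Rightarrow> 'g \<Rightarrow> 'g) \<Rightarrow> ('g \<Rightarrow> 'g \<Rightarrow> complex) \<Rightarrow>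
   ('r::finite option \<Rightarrow> 'g \<Rightarrow> 'g) \<Rightarrow> ('r option \<Rightarrow> nat) \<Rightarrow> complex \<Rightarrow>
   ((('g, 'r) toroidal, 'g \<times> complex) pre_tensor set \<Rightarrow> int \<Rightarrow> int ^ 'r \<Rightarrow>
    (('g, 'r) toroidal, 'g \<times> complex) pre_tensor set \<Rightarrow>
    (('g, 'r) toroidal, 'g \<times> complex) pre_tensor set) \<Rightarrow> bool" where
  "is_VL_structure sc br form \<sigma> N l Y \<longleftrightarrow>
     toroidal_vertex_algebra (VL sc br form \<sigma> N l) Y (VL_vac sc br form \<sigma> N l) \<and>
     (\<forall>k. \<forall>a\<in>grade_space sc \<sigma> N k. \<forall>m0 m. \<forall>v\<in>carrier (VL sc br form \<sigma> N l).
        Y (VL_inc sc br form \<sigma> N l a) m0 m v =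
          VL_act sc br form \<sigma> N l (current_coeff N k a m0 m) v)"

end

theory Submission
  imports Defs
begin

text \<open>The automorphism \<open>\<sigma>\<^sub>i\<close> acts on \<open>\<L>\<close> and on \<open>(\<gg> \<oplus> \<complex>)\<^sub>\<ell>\<close> (the Killing form is invariant because a
  trace does not change under conjugation), and these actions are compatible, so they induce a
  linear bijection \<open>\<tau>\<close> of the induced module with \<open>\<tau> (x v) = \<sigma>\<^sub>i(x) \<tau> v\<close>. Thus \<open>\<tau>\<close> respects the
  modes of each homogeneous \<open>a \<in> \<gg>\<close>. The residue in \<open>x\<^sub>0\<close> of the Jacobi identity writes the modes
  of \<open>u\<^sub>n v\<close> in terms of products of modes of \<open>u\<close> and \<open>v\<close>, so the set of \<open>u\<close> whose modes \<open>\<tau>\<close>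
  respects is closed under modes. It is everything, since \<open>\<one>\<close> and \<open>\<gg>\<close> generate \<open>V\<close> under the modes
  of homogeneous elements: these span \<open>\<gg>\<close>, as commuting operators of finite order are
  simultaneously diagonalizable, and the central \<open>c\<close> acts as a scalar. Generation also gives
  uniqueness.\<close>

section \<open>Relabelling finitely supported functions\<close>

text \<open>HOL-Algebra claims the notation of the inverse function for groups.\<close>

abbreviation finv :: "('a \<Rightarrow> 'b) \<Rightarrow> 'b \<Rightarrow> 'a" where
  "finv \<equiv> inv_into UNIV"

lemma lookup_fscale [simp]: "Poly_Mapping.lookup (fscale c f) k = c * Poly_Mapping.lookup f k"
  by (simp add: fscale_def Poly_Mapping.map.rep_eq when_def)

interpretation fscale: vector_space fscale
  by unfold_locales (auto intro!: poly_mapping_eqI simp: lookup_add algebra_simps)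

lemma fscale_single [simp]: "fscale c (Poly_Mapping.single k a) = Poly_Mapping.single k (c * a)"
  by (rule poly_mapping_eqI) (simp add: lookup_single when_def)

text \<open>The case \<open>single\<close> ranges over the terms of f itself, so that a condition on
  the keys of f, such as words having their letters in L, is available there.\<close>

lemma poly_mapping_add_induct [case_names single add zero]:
  fixes f :: "'a \<Rightarrow>\<^sub>0 'b::comm_monoid_add"
  assumes single: "\<And>k. k \<in> Poly_Mapping.keys f \<Longrightarrow> P (Poly_Mapping.single k (Poly_Mapping.lookup f k))"
    and add: "\<And>g h. P g \<Longrightarrow> P h \<Longrightarrow> P (g + h)"
    and zero: "P 0"
  shows "P f"
proof -
  have "P (\<Sum>k\<in>A. Poly_Mapping.single k (Poly_Mapping.lookup f k))"
    if "finite A" "A \<subseteq> Poly_Mapping.keys f" for A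
    using that by (induction A rule: finite_induct) (auto intro: single add zero)
  moreover have "f = (\<Sum>k\<in>Poly_Mapping.keys f. Poly_Mapping.single k (Poly_Mapping.lookup f k))"
    by (rule poly_mapping_eqI) (simp add: lookup_sum lookup_single when_def in_keys_iff)
  ultimately show ?thesis
    by (metis finite_keys order_refl)
qed

text \<open>The push-forward of coefficients along a bijection h, encoded as pull-back along its
  inverse because \<open>map_key\<close> pulls back along injective maps.\<close>

definition relabel :: "('a \<Rightarrow> 'b) \<Rightarrow> ('a \<Rightarrow>\<^sub>0 'c::zero) \<Rightarrow> 'b \<Rightarrow>\<^sub>0 'c" where
  "relabel h = Poly_Mapping.map_key (finv h)"

context
  fixes h :: "'a \<Rightarrow> 'b"
  assumes h: "bij h"
begin

lemma inj_inv_h: "inj (finv h)"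
  by (simp add: bij_imp_bij_inv bij_is_inj h)

lemma lookup_relabel: "Poly_Mapping.lookup (relabel h f) k = Poly_Mapping.lookup f (finv h k)"
  by (simp add: relabel_def Poly_Mapping.map_key.rep_eq inj_inv_h)

lemma lookup_relabel_image [simp]: "Poly_Mapping.lookup (relabel h f) (h k) = Poly_Mapping.lookup f k"
  by (simp add: lookup_relabel h bij_is_inj)

lemma relabel_eqI:
  assumes "\<And>k. Poly_Mapping.lookup g (h k) = Poly_Mapping.lookup f k"
  shows "relabel h f = g"
proof (rule poly_mapping_eqI)
  fix k
  show "Poly_Mapping.lookup (relabel h f) k = Poly_Mapping.lookup g k"
    using assms[of "finv h k"] by (simp add: lookup_relabel surj_f_inv_f h bij_is_surj)
qed

lemma relabel_zero [simp]: "relabel h 0 = 0"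
  by (rule relabel_eqI) simp

lemma relabel_single [simp]: "relabel h (Poly_Mapping.single k a) = Poly_Mapping.single (h k) a"
  by (rule relabel_eqI) (simp add: lookup_single when_def inj_eq[OF bij_is_inj[OF h]])

lemma keys_relabel: "Poly_Mapping.keys (relabel h f) = h ` Poly_Mapping.keys f"
proof (rule Set.set_eqI)
  fix k
  obtain k' where "k = h k'"
    using h by (metis bij_pointE)
  then show "k \<in> Poly_Mapping.keys (relabel h f) \<longleftrightarrow> k \<in> h ` Poly_Mapping.keys f"
    by (simp add: in_keys_iff inj_image_mem_iff[OF bij_is_inj[OF h]])
qed

lemma relabel_inv: "relabel (finv h) (relabel h f) = f" "relabel h (relabel (finv h) g) = g"
proof -
  show "relabel h (relabel (finv h) g) = g"
    using bij_imp_bij_inv[OF h] inv_inv_eq[OF h] 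
    by (intro relabel_eqI) (simp add: relabel_def Poly_Mapping.map_key.rep_eq bij_is_inj h)
  show "relabel (finv h) (relabel h f) = f"
    by (rule poly_mapping_eqI) (simp add: relabel_def Poly_Mapping.map_key.rep_eq bij_is_inj h
      bij_imp_bij_inv inv_inv_eq inv_f_f surj_f_inv_f)
qed

lemma bij_relabel: "bij (relabel h :: ('a \<Rightarrow>\<^sub>0 'c::zero) \<Rightarrow> 'b \<Rightarrow>\<^sub>0 'c)"
  by (rule o_bij[where g = "relabel (finv h)"]) (auto simp: relabel_inv)

lemma relabel_add: "relabel h (f + g :: 'a \<Rightarrow>\<^sub>0 'c::monoid_add) = relabel h f + relabel h g"
  by (rule relabel_eqI) (simp add: lookup_add)

lemma relabel_diff: "relabel h (f - g :: 'a \<Rightarrow>\<^sub>0 'c::cancel_comm_monoid_add) = relabel h f - relabel h g"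
  by (rule relabel_eqI) (simp add: lookup_minus)

lemma relabel_sum: "relabel h (sum g A) = (\<Sum>x\<in>A. relabel h (g x :: 'a \<Rightarrow>\<^sub>0 'c::comm_monoid_add))"
  by (induction A rule: infinite_finite_induct) (simp_all add: relabel_add)

lemma relabel_fscale: "relabel h (fscale c f) = fscale c (relabel h f)"
  by (rule relabel_eqI) simp

lemma relabel_image_span: "relabel h ` fscale.span R = fscale.span (relabel h ` R)"
proof -
  have "Vector_Spaces.linear fscale fscale (relabel h)"
    by unfold_locales (auto simp: relabel_add relabel_fscale)
  then interpret Vector_Spaces.linear fscale fscale "relabel h" .
  show ?thesis
    by (simp add: span_image)
qed

lemma lin_ext_relabel: "lin_ext sc \<psi> (relabel h f) = lin_ext sc (\<lambda>k. \<psi> (h k)) f"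
  using bij_is_inj[OF h] by (simp add: lin_ext_def keys_relabel sum.reindex inj_on_def inj_def)

end

text \<open>Both sides are additive in f and in g, which leaves single terms; there the convolution
  adds the keys, and h respects this sum.\<close>

lemma relabel_mult:
  fixes h :: "'a::monoid_add \<Rightarrow> 'b::monoid_add" and f g :: "'a \<Rightarrow>\<^sub>0 'c::semiring_0"
  assumes h: "bij h" and add: "\<And>v w. h (v + w) = h v + h w"
  shows "relabel h (f * g) = relabel h f * relabel h g"
proof (induction f rule: poly_mapping_add_induct)
  case (single k)
  show ?case
    by (induction g rule: poly_mapping_add_induct)
      (auto simp: mult_single h add relabel_add distrib_left)
qed (auto simp: h relabel_add distrib_right)

section \<open>Free and enveloping algebras\<close>

lemma free_alg_ring_simps [simp]:
  "carrier (free_alg_ring L) = {f. \<forall>w\<in>Poly_Mapping.keys f. set (letters w) \<subseteq> L}"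
  "monoid.mult (free_alg_ring L) = (*)" "monoid.one (free_alg_ring L) = 1"
  "ring.zero (free_alg_ring L) = 0" "add (free_alg_ring L) = (+)"
  by (auto simp: free_alg_ring_def ring_of_type_algebra_def fun_eq_iff)

lemma letters_plus [simp]: "letters (v + w) = letters v @ letters w"
  by (simp add: plus_free_word_def)

lemma letters_zero [simp]: "letters 0 = []"
  by (simp add: zero_free_word_def)

lemma free_alg_carrier_closed_unary:
  assumes "f \<in> carrier (free_alg_ring L)"
  shows "- f \<in> carrier (free_alg_ring L)" "fscale c f \<in> carrier (free_alg_ring L)"
  using assms by (auto simp: in_keys_iff)

lemma free_alg_carrier_closed:
  assumes "f \<in> carrier (free_alg_ring L)" "g \<in> carrier (free_alg_ring L)"
  shows "f + g \<in> carrier (free_alg_ring L)" "f * g \<in> carrier (free_alg_ring L)"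
    "f - g \<in> carrier (free_alg_ring L)"
proof -
  have add: "f + g \<in> carrier (free_alg_ring L)"
    if "f \<in> carrier (free_alg_ring L)" "g \<in> carrier (free_alg_ring L)" for f g :: "'a free_alg"
    using that Poly_Mapping.keys_add[of f g] by fastforce
  show "f + g \<in> carrier (free_alg_ring L)"
    by (rule add[OF assms])
  show "f - g \<in> carrier (free_alg_ring L)"
    using add[OF assms(1) free_alg_carrier_closed_unary(1)[OF assms(2)]] by simp
  show "f * g \<in> carrier (free_alg_ring L)"
    using assms Poly_Mapping.keys_mult[of f g] by fastforce
qed

lemma ring_free_alg_ring: "ring (free_alg_ring L)"
proof (rule ringI)
  show "abelian_group (free_alg_ring L)"
  proof (rule abelian_groupI)
    fix f assume "f \<in> carrier (free_alg_ring L)"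
    then have "- f \<in> carrier (free_alg_ring L)" "- f \<oplus>\<^bsub>free_alg_ring L\<^esub> f = \<zero>\<^bsub>free_alg_ring L\<^esub>"
      by (auto dest: free_alg_carrier_closed_unary(1))
    then show "\<exists>g\<in>carrier (free_alg_ring L). g \<oplus>\<^bsub>free_alg_ring L\<^esub> f = \<zero>\<^bsub>free_alg_ring L\<^esub>"
      by blast
  next
    fix f g assume "f \<in> carrier (free_alg_ring L)" "g \<in> carrier (free_alg_ring L)"
    from free_alg_carrier_closed(1)[OF this]
    show "f \<oplus>\<^bsub>free_alg_ring L\<^esub> g \<in> carrier (free_alg_ring L)"
      by simp
  qed (auto simp: algebra_simps)
  show "Group.monoid (free_alg_ring L)"
  proof (rule Group.monoidI)
    fix f g assume "f \<in> carrier (free_alg_ring L)" "g \<in> carrier (free_alg_ring L)"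
    from free_alg_carrier_closed(2)[OF this]
    show "f \<otimes>\<^bsub>free_alg_ring L\<^esub> g \<in> carrier (free_alg_ring L)"
      by simp
  qed (auto simp: algebra_simps)
qed (auto simp: algebra_simps)

lemma gen_in_carrier [simp]: "x \<in> L \<Longrightarrow> gen x \<in> carrier (free_alg_ring L)"
  by (simp add: gen_def)

locale lie_subset = vector_space sc
  for sc :: "complex \<Rightarrow> 'l::ab_group_add \<Rightarrow> 'l" +
  fixes br :: "'l \<Rightarrow> 'l \<Rightarrow> 'l"
    and L :: "'l set"
  assumes subspace_L: "subspace L"
    and L_br: "x \<in> L \<Longrightarrow> y \<in> L \<Longrightarrow> br x y \<in> L"
begin

abbreviation "U \<equiv> uea sc br L"
abbreviation "cls \<equiv> uea_class sc br L"
abbreviation "I \<equiv> uea_ideal sc br L"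

lemmas L_add = subspace_add[OF subspace_L]
  and L_scale = subspace_scale[OF subspace_L]

lemma uea_rels_carrier: "uea_rels sc br L \<subseteq> carrier (free_alg_ring L)"
proof -
  note closed = free_alg_carrier_closed free_alg_carrier_closed_unary
  show ?thesis
    unfolding uea_rels_def
    by (auto simp del: free_alg_ring_simps intro!: closed L_add L_scale L_br gen_in_carrier)
qed

lemma ideal_I: "ideal I (free_alg_ring L)"
  unfolding uea_ideal_def by (rule ring.genideal_ideal[OF ring_free_alg_ring uea_rels_carrier])

lemma rels_in_I: "uea_rels sc br L \<subseteq> I"
  unfolding uea_ideal_def by (rule ring.genideal_self[OF ring_free_alg_ring uea_rels_carrier])

lemma ring_U: "ring U"
  unfolding uea_def by (rule ideal.quotient_is_ring[OF ideal_I])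

lemma cls_ring_hom: "ring_hom_ring (free_alg_ring L) U cls"
  using ideal.rcos_ring_hom_ring[OF ideal_I]
  by (simp add: uea_def uea_class_def[abs_def])

lemma carrier_U: "carrier U = cls ` carrier (free_alg_ring L)"
  by (auto simp: uea_def FactRing_def A_RCOSETS_def' uea_class_def)

text \<open>In f = (f - g) + g the first summand lies in the ideal, so f lies in the coset of g, and
  a coset is determined by any of its elements.\<close>

lemma cls_eqI:
  assumes "f \<in> carrier (free_alg_ring L)" "g \<in> carrier (free_alg_ring L)" "f - g \<in> I"
  shows "cls f = cls g"
proof -
  interpret I: ideal I "free_alg_ring L" by (rule ideal_I)
  have "f = (f - g) \<oplus>\<^bsub>free_alg_ring L\<^esub> g" by simp
  then have "f \<in> I +>\<^bsub>free_alg_ring L\<^esub> g"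
    using assms(3) by (fastforce simp: a_r_coset_def' intro: bexI[of _ "f - g"])
  then show ?thesis
    using I.a_repr_independence'[OF _ assms(2)] by (simp add: uea_class_def)
qed

end

section \<open>Induced modules\<close>

locale lie_induced = lie_subset sc br L
  for sc :: "complex \<Rightarrow> 'l::ab_group_add \<Rightarrow> 'l" and br L +
  fixes P :: "'l set"
    and scaleM :: "complex \<Rightarrow> 'm::ab_group_add \<Rightarrow> 'm"
    and \<rho> :: "'l \<Rightarrow> 'm \<Rightarrow> 'm"
  assumes P_L: "P \<subseteq> L"
    and scaleM_one: "scaleM 1 m = m"
begin

abbreviation "rels \<equiv> tensor_rels sc br L P scaleM \<rho>"
abbreviation "K \<equiv> tensor_ker sc br L P scaleM \<rho>"
abbreviation "V \<equiv> induced_module sc br L P scaleM \<rho>"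

end

text \<open>Everything is transported by taking images under bijections, so that no
  well-definedness on cosets has to be checked.\<close>

locale induced_iso = lie_induced sc br L P scaleM \<rho>
  for sc :: "complex \<Rightarrow> 'l::ab_group_add \<Rightarrow> 'l" and br L P
    and scaleM :: "complex \<Rightarrow> 'm::ab_group_add \<Rightarrow> 'm" and \<rho> +
  fixes s :: "'l \<Rightarrow> 'l"
    and t :: "'m \<Rightarrow> 'm"
  assumes bij_s: "bij s"
    and s_add: "s (x + y) = s x + s y"
    and s_scale: "s (sc c x) = sc c (s x)"
    and s_br: "s (br x y) = br (s x) (s y)"
    and s_L: "s ` L = L"
    and s_P: "s ` P = P"
    and bij_t: "bij t"
    and t_add: "t (m + m') = t m + t m'"
    and t_scale: "t (scaleM c m) = scaleM c (t m)"
    and t_act: "x \<in> P \<Longrightarrow> t (\<rho> x m) = \<rho> (s x) (t m)"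
begin

definition word_map :: "'l free_word \<Rightarrow> 'l free_word" where
  "word_map w = Free_Word (map s (letters w))"

abbreviation "alg_map \<equiv> relabel word_map :: 'l free_alg \<Rightarrow> 'l free_alg"

abbreviation "tensor_map \<equiv>
  relabel (\<lambda>(u, m). (alg_map ` u, t m)) :: ('l, 'm) pre_tensor \<Rightarrow> ('l, 'm) pre_tensor"

lemma bij_word_map: "bij word_map"
proof (rule o_bij)
  show "(\<lambda>w. Free_Word (map (finv s) (letters w))) \<circ> word_map = id"
    by (auto simp: word_map_def fun_eq_iff bij_is_inj[OF bij_s])
  show "word_map \<circ> (\<lambda>w. Free_Word (map (finv s) (letters w))) = id"
    by (auto simp: word_map_def fun_eq_iff bij_is_surj[OF bij_s] surj_f_inv_f comp_def)
qed

lemma bij_alg_map: "bij alg_map"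
  by (rule bij_relabel[OF bij_word_map])

lemma alg_map_simps [simp]:
  "alg_map (f + g) = alg_map f + alg_map g"
  "alg_map (f - g) = alg_map f - alg_map g"
  "alg_map (f * g) = alg_map f * alg_map g"
  "alg_map (fscale c f) = fscale c (alg_map f)"
  "alg_map 0 = 0"
  "alg_map 1 = 1"
  "alg_map (gen x) = gen (s x)"
proof -
  have "word_map (v + w) = word_map v + word_map w" "word_map 0 = 0" for v w
    by (auto simp: word_map_def plus_free_word_def zero_free_word_def)
  then show "alg_map (f * g) = alg_map f * alg_map g" "alg_map 1 = 1"
    using relabel_single[OF bij_word_map, of 0 "1 :: complex"]
    by (auto simp: relabel_mult[OF bij_word_map])
qed (auto simp: bij_word_map relabel_add relabel_diff relabel_fscale gen_def word_map_def)

text \<open>Stated for any set Q of letters since it is applied both to L, for the enveloping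
  algebra, and to P, for the relations of the tensor product.\<close>

lemma alg_map_closed:
  assumes "s ` Q \<subseteq> Q" "f \<in> carrier (free_alg_ring Q)"
  shows "alg_map f \<in> carrier (free_alg_ring Q)"
  using assms by (fastforce simp: keys_relabel[OF bij_word_map] word_map_def)

lemma alg_map_uea_rels: "alg_map ` uea_rels sc br L \<subseteq> uea_rels sc br L"
proof -
  have "s x \<in> L" if "x \<in> L" for x
    using that s_L by blast
  then show ?thesis
    unfolding uea_rels_def image_Un
    by (intro Un_mono) (auto simp: s_add s_scale s_br, blast+)
qed

text \<open>The preimage of \<open>I\<close> under the ring endomorphism \<open>alg_map\<close> is
  an ideal; it contains the defining relations, hence all of \<open>I\<close> by minimality.\<close>

lemma alg_map_ideal_subset: "alg_map ` I \<subseteq> I"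
proof
  let ?R = "free_alg_ring L"
  fix g assume "g \<in> alg_map ` I"
  then obtain f where f: "f \<in> I" "g = alg_map f" by blast
  have hom: "ring_hom_ring ?R ?R alg_map"
    using alg_map_closed[of L] s_L
    by (intro ring_hom_ringI ring_free_alg_ring) (auto simp del: free_alg_ring_simps(1))
  have "{f \<in> carrier ?R. alg_map f \<in> I} \<supseteq> uea_rels sc br L"
    using uea_rels_carrier alg_map_uea_rels rels_in_I by blast
  then have "I \<subseteq> {f \<in> carrier ?R. alg_map f \<in> I}"
    using ring.genideal_minimal[OF ring_free_alg_ring ring_hom_ring.ideal_vimage[OF hom ideal_I]]
    by (simp add: uea_ideal_def)
  then show "g \<in> I" using f by blast
qed

text \<open>By this symmetry each inclusion of an image also holds for the inverse maps. This turns
  the inclusions for \<open>I\<close> and \<open>K\<close> into equalities and makes the map on the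
  carrier bijective.\<close>

lemma induced_iso_inverse:
  "induced_iso sc br L P scaleM \<rho> (finv s) (finv t)"
proof -
  note s_inv = surj_f_inv_f[OF bij_is_surj[OF bij_s]] inv_f_f[OF bij_is_inj[OF bij_s]]
  note t_inv = surj_f_inv_f[OF bij_is_surj[OF bij_t]] inv_f_f[OF bij_is_inj[OF bij_t]]
  have s_L': "finv s ` L = L" and s_P': "finv s ` P = P"
    using s_L s_P s_inv by (metis image_inv_f_f bij_is_inj[OF bij_s])+
  show ?thesis
  proof unfold_locales
    fix x y c m m'
    show "finv s (x + y) = finv s x + finv s y" by (metis s_add s_inv)
    show "finv s (sc c x) = sc c (finv s x)" by (metis s_scale s_inv)
    show "finv s (br x y) = br (finv s x) (finv s y)" by (metis s_br s_inv)
    show "finv t (m + m') = finv t m + finv t m'" by (metis t_add t_inv)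
    show "finv t (scaleM c m) = scaleM c (finv t m)" by (metis t_scale t_inv)
    show "finv t (\<rho> x m) = \<rho> (finv s x) (finv t m)" if "x \<in> P"
      using that s_P' by (metis t_act t_inv s_inv imageI)
  qed (use P_L s_L' s_P' bij_s bij_t in \<open>auto simp: bij_imp_bij_inv\<close>)
qed

text \<open>The inverse instance of the locale has its own letterwise map; identifying it with the
  inverse of \<open>word_map\<close> lets the two relabellings cancel.\<close>

lemma word_map_inverse: "induced_iso.word_map (finv s) = finv word_map"
  by (rule sym, rule inv_unique_comp)
    (auto simp: word_map_def induced_iso.word_map_def[OF induced_iso_inverse] fun_eq_iff comp_def
      surj_f_inv_f[OF bij_is_surj[OF bij_s]] inv_f_f[OF bij_is_inj[OF bij_s]])

lemma alg_map_ideal: "alg_map ` I = I"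
proof
  interpret inv: induced_iso sc br L P scaleM \<rho> "finv s" "finv t"
    by (rule induced_iso_inverse)
  show "I \<subseteq> alg_map ` I"
  proof
    fix f assume "f \<in> I"
    then have "inv.alg_map f \<in> I"
      using inv.alg_map_ideal_subset by blast
    moreover have "f = alg_map (inv.alg_map f)"
      by (simp add: word_map_inverse relabel_inv[OF bij_word_map])
    ultimately show "f \<in> alg_map ` I" by blast
  qed
qed (rule alg_map_ideal_subset)

lemma alg_map_cls: "alg_map ` cls f = cls (alg_map f)"
proof -
  have "alg_map ` cls f = (\<Union>g\<in>I. {alg_map g + alg_map f})"
    by (simp add: uea_class_def a_r_coset_def' image_UN)
  also have "\<dots> = (\<Union>g\<in>alg_map ` I. {g + alg_map f})"
    by simp
  finally show ?thesis
    unfolding alg_map_ideal by (simp add: uea_class_def a_r_coset_def')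
qed

lemma alg_map_mult: "alg_map ` (A \<otimes>\<^bsub>U\<^esub> B) = alg_map ` A \<otimes>\<^bsub>U\<^esub> alg_map ` B"
  using alg_map_cls
  by (simp add: uea_def FactRing_def rcoset_mult_def image_UN uea_class_def)

lemma alg_map_add: "alg_map ` (A \<oplus>\<^bsub>U\<^esub> B) = alg_map ` A \<oplus>\<^bsub>U\<^esub> alg_map ` B"
  by (auto simp: uea_def FactRing_def set_add_def' image_iff) (metis alg_map_simps(1))+

lemma alg_map_one: "alg_map ` \<one>\<^bsub>U\<^esub> = \<one>\<^bsub>U\<^esub>"
  using alg_map_cls[of 1] by (simp add: uea_def FactRing_def uea_class_def)

lemma alg_map_carrier: "u \<in> carrier U \<Longrightarrow> alg_map ` u \<in> carrier U"
  unfolding carrier_U using alg_map_closed[of L] s_L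
  by (auto simp: alg_map_cls simp del: free_alg_ring_simps)

abbreviation "key_map \<equiv> \<lambda>(u, m). (alg_map ` u, t m)"

lemma bij_key_map: "bij key_map"
proof -
  \<comment> \<open>\<open>alg_map\<close> permutes all subsets of the free algebra, cosets or not;
    relabelling requires a bijection of the whole key type.\<close>
  have "bij ((`) alg_map)"
    using bij_betw_Pow[OF bij_alg_map] by simp
  then have "bij (map_prod ((`) alg_map) t)"
    using bij_t by (simp add: bij_def prod.inj_map map_prod_surj)
  then show ?thesis
    by (simp add: map_prod_def)
qed

lemma tensor_map_simps [simp]:
  "tensor_map (f + g) = tensor_map f + tensor_map g"
  "tensor_map (f - g) = tensor_map f - tensor_map g"
  "tensor_map (fscale c f) = fscale c (tensor_map f)"
  "tensor_map (Poly_Mapping.single (u, m) c) = Poly_Mapping.single (alg_map ` u, t m) c"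
  by (simp_all add: bij_key_map relabel_add relabel_diff relabel_fscale)

lemma t_zero: "t 0 = 0"
  using t_add[of 0 0] by simp

lemma t_sum: "t (sum f A) = (\<Sum>x\<in>A. t (f x))"
  by (induction A rule: infinite_finite_induct) (auto simp: t_zero t_add)

text \<open>Along a word, t moves past one letter after the other. All letters lie in P, where
  \<open>t_act\<close> is available.\<close>

lemma t_free_alg_act:
  assumes "f \<in> carrier (free_alg_ring P)"
  shows "t (free_alg_act scaleM \<rho> f m) = free_alg_act scaleM \<rho> (alg_map f) (t m)"
proof -
  have word: "t (foldr \<rho> xs m) = foldr \<rho> (map s xs) (t m)" if "set xs \<subseteq> P" for xs
    using that by (induction xs) (auto simp: t_act)
  have "t (free_alg_act scaleM \<rho> f m) =
      (\<Sum>w\<in>Poly_Mapping.keys f. scaleM (Poly_Mapping.lookup f w) (t (foldr \<rho> (letters w) m)))"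
    by (simp add: free_alg_act_def lin_ext_def t_sum t_scale)
  also have "\<dots> = free_alg_act scaleM \<rho> (alg_map f) (t m)"
    using assms word unfolding free_alg_act_def lin_ext_relabel[OF bij_word_map]
    by (auto simp: lin_ext_def word_map_def intro!: sum.cong)
  finally show ?thesis .
qed

lemma alg_map_carrier_P: "f \<in> carrier (free_alg_ring P) \<Longrightarrow> alg_map f \<in> carrier (free_alg_ring P)"
  using alg_map_closed[of P] s_P by blast

text \<open>Each of the five families of relations is carried into itself, with u and m replaced by
  their images. The scalar family uses that \<open>alg_map\<close> fixes the multiples of 1, the
  last one that t is compatible with the action of U(P).\<close>

lemma tensor_map_rels: "tensor_map ` rels \<subseteq> rels"
proof (rule image_subsetI)
  fix f assume "f \<in> rels"
  then consider
      (add_left) u u' m where "u \<in> carrier U" "u' \<in> carrier U"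
        "f = pure_tensor (u \<oplus>\<^bsub>U\<^esub> u') m - pure_tensor u m - pure_tensor u' m"
    | (add_right) u m m' where "u \<in> carrier U"
        "f = pure_tensor u (m + m') - pure_tensor u m - pure_tensor u m'"
    | (scale_left) c u m where "u \<in> carrier U"
        "f = pure_tensor (cls (fscale c 1) \<otimes>\<^bsub>U\<^esub> u) m - fscale c (pure_tensor u m)"
    | (scale_right) c u m where "u \<in> carrier U"
        "f = pure_tensor u (scaleM c m) - fscale c (pure_tensor u m)"
    | (act) u g m where "u \<in> carrier U" "g \<in> carrier (free_alg_ring P)"
        "f = pure_tensor (u \<otimes>\<^bsub>U\<^esub> cls g) m - pure_tensor u (free_alg_act scaleM \<rho> g m)"
    unfolding tensor_rels_def Let_def Un_iff mem_Collect_eq by (elim disjE exE conjE) blast+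
  then show "tensor_map f \<in> rels"
  proof cases
    case add_left
    then have "tensor_map f = pure_tensor (alg_map ` u \<oplus>\<^bsub>U\<^esub> alg_map ` u') (t m)
        - pure_tensor (alg_map ` u) (t m) - pure_tensor (alg_map ` u') (t m)"
      by (simp only: tensor_map_simps alg_map_add)
    then show ?thesis
      using add_left(1,2)[THEN alg_map_carrier] unfolding tensor_rels_def Let_def by blast
  next
    case add_right
    then have "tensor_map f = pure_tensor (alg_map ` u) (t m + t m')
        - pure_tensor (alg_map ` u) (t m) - pure_tensor (alg_map ` u) (t m')"
      by (simp only: tensor_map_simps t_add)
    then show ?thesis
      using alg_map_carrier[OF add_right(1)] unfolding tensor_rels_def Let_def by blast
  next
    case scale_left
    then have "tensor_map f = pure_tensor (cls (fscale c 1) \<otimes>\<^bsub>U\<^esub> (alg_map ` u)) (t m)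
        - fscale c (pure_tensor (alg_map ` u) (t m))"
      by (simp only: tensor_map_simps alg_map_mult alg_map_cls alg_map_simps)
    then show ?thesis
      using alg_map_carrier[OF scale_left(1)] unfolding tensor_rels_def Let_def by blast
  next
    case scale_right
    then have "tensor_map f = pure_tensor (alg_map ` u) (scaleM c (t m))
        - fscale c (pure_tensor (alg_map ` u) (t m))"
      by (simp only: tensor_map_simps t_scale)
    then show ?thesis
      using alg_map_carrier[OF scale_right(1)] unfolding tensor_rels_def Let_def by blast
  next
    case act
    then have "tensor_map f = pure_tensor (alg_map ` u \<otimes>\<^bsub>U\<^esub> cls (alg_map g)) (t m)
        - pure_tensor (alg_map ` u) (free_alg_act scaleM \<rho> (alg_map g) (t m))"
      by (simp only: tensor_map_simps alg_map_mult alg_map_cls t_free_alg_act)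
    then show ?thesis
      using alg_map_carrier[OF act(1)] alg_map_carrier_P[OF act(2)]
      unfolding tensor_rels_def Let_def by blast
  qed
qed

lemma key_map_inverse:
  "(\<lambda>(u, m). (relabel (induced_iso.word_map (finv s)) ` u, finv t m)) = finv key_map"
  by (rule sym, rule inv_unique_comp)
    (auto simp: fun_eq_iff image_comp comp_def word_map_inverse relabel_inv[OF bij_word_map]
      surj_f_inv_f[OF bij_is_surj[OF bij_t]] inv_f_f[OF bij_is_inj[OF bij_t]])

lemma tensor_map_ker_subset: "tensor_map ` K \<subseteq> K"
  unfolding tensor_ker_def relabel_image_span[OF bij_key_map]
  by (rule fscale.span_mono[OF tensor_map_rels])

lemma tensor_map_ker: "tensor_map ` K = K"
proof
  interpret inv: induced_iso sc br L P scaleM \<rho> "finv s" "finv t"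
    by (rule induced_iso_inverse)
  show "K \<subseteq> tensor_map ` K"
  proof
    fix f assume "f \<in> K"
    then have "inv.tensor_map f \<in> K"
      using inv.tensor_map_ker_subset by blast
    moreover have "f = tensor_map (inv.tensor_map f)"
      by (simp add: key_map_inverse relabel_inv[OF bij_key_map])
    ultimately show "f \<in> tensor_map ` K" by blast
  qed
qed (rule tensor_map_ker_subset)

lemma image_vs_coset: "tensor_map ` vs_coset K f = vs_coset K (tensor_map f)"
proof -
  have "tensor_map ` vs_coset K f = (\<lambda>h. tensor_map f + h) ` tensor_map ` K"
    by (simp add: vs_coset_def Setcompr_eq_image image_image)
  then show ?thesis
    by (simp add: tensor_map_ker vs_coset_def Setcompr_eq_image)
qed

lemma image_coset_lift:
  assumes "\<And>f. tensor_map (\<phi> f) = \<psi> (tensor_map f)"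
  shows "tensor_map ` coset_lift K \<phi> A = coset_lift K \<psi> (tensor_map ` A)"
  by (simp add: coset_lift_def image_UN image_vs_coset assms)

lemma image_carrier: "(`) tensor_map ` carrier V \<subseteq> carrier V"
proof -
  have "fst ` Poly_Mapping.keys (tensor_map f) \<subseteq> carrier U"
    if "fst ` Poly_Mapping.keys f \<subseteq> carrier U" for f
  proof -
    have "fst ` Poly_Mapping.keys (tensor_map f) = (\<lambda>k. alg_map ` fst k) ` Poly_Mapping.keys f"
      by (simp add: keys_relabel[OF bij_key_map] image_image case_prod_beta)
    then show ?thesis
      using that by (auto intro: alg_map_carrier)
  qed
  then show ?thesis
    unfolding induced_module_def quotient_space_def
    by (simp add: image_vs_coset image_subset_iff)
qed

lemma bij_betw_carrier: "bij_betw ((`) tensor_map) (carrier V) (carrier V)"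
proof (rule bij_betwI)
  interpret inv: induced_iso sc br L P scaleM \<rho> "finv s" "finv t"
    by (rule induced_iso_inverse)
  show "(`) tensor_map \<in> carrier V \<rightarrow> carrier V" "(`) inv.tensor_map \<in> carrier V \<rightarrow> carrier V"
    using image_carrier inv.image_carrier by (simp_all only: image_subset_iff_funcset)
  fix A :: "('l, 'm) pre_tensor set"
  show "inv.tensor_map ` tensor_map ` A = A" "tensor_map ` inv.tensor_map ` A = A"
    unfolding key_map_inverse image_image relabel_inv[OF bij_key_map] by simp_all
qed

lemma image_add: "tensor_map ` (A \<oplus>\<^bsub>V\<^esub> B) = tensor_map ` A \<oplus>\<^bsub>V\<^esub> tensor_map ` B"
  by (simp add: induced_module_def quotient_space_def image_UN image_vs_coset)

lemma image_smult: "tensor_map ` (c \<odot>\<^bsub>V\<^esub> A) = c \<odot>\<^bsub>V\<^esub> tensor_map ` A"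
  by (simp add: induced_module_def quotient_space_def image_coset_lift)

lemma image_emb:
  "tensor_map ` induced_emb sc br L P scaleM \<rho> m = induced_emb sc br L P scaleM \<rho> (t m)"
  by (simp add: induced_emb_def image_vs_coset alg_map_one)

lemma image_act:
  "tensor_map ` induced_act sc br L P scaleM \<rho> x A =
     induced_act sc br L P scaleM \<rho> (s x) (tensor_map ` A)"
proof -
  have map_lin_ext: "tensor_map (lin_ext fscale \<psi> f) = lin_ext fscale (\<lambda>k. tensor_map (\<psi> k)) f" for \<psi> f
    by (simp add: lin_ext_def relabel_sum[OF bij_key_map])
  \<comment> \<open>On a pair (u, m), multiplicativity of \<open>alg_map\<close> on cosets turns
    left multiplication by x into left multiplication by s x; linear extension does the
    rest.\<close>
  have "tensor_map (case k of (u, m) \<Rightarrow> pure_tensor (cls (gen x) \<otimes>\<^bsub>U\<^esub> u) m) =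
      (case key_map k of (u, m) \<Rightarrow> pure_tensor (cls (gen (s x)) \<otimes>\<^bsub>U\<^esub> u) m)" for k
    by (cases k) (simp only: prod.case tensor_map_simps alg_map_mult alg_map_cls alg_map_simps)
  then show ?thesis
    unfolding induced_act_def
    by (intro image_coset_lift) (simp only: map_lin_ext lin_ext_relabel[OF bij_key_map])
qed

end

section \<open>Relations and generation in the enveloping algebra\<close>

context lie_subset
begin

lemma cls_simps:
  assumes "f \<in> carrier (free_alg_ring L)" "g \<in> carrier (free_alg_ring L)"
  shows "cls (f + g) = cls f \<oplus>\<^bsub>U\<^esub> cls g" "cls (f * g) = cls f \<otimes>\<^bsub>U\<^esub> cls g"
  using ring_hom_ring.homh[OF cls_ring_hom] assms
  by (auto simp: ring_hom_def simp del: free_alg_ring_simps(1))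

lemma cls_one: "cls 1 = \<one>\<^bsub>U\<^esub>"
  using ring_hom_ring.homh[OF cls_ring_hom] by (simp add: ring_hom_def)

lemma one_in_carrier [simp]: "1 \<in> carrier (free_alg_ring L)"
  by simp

lemma word_in_carrier: "set xs \<subseteq> L \<Longrightarrow> Poly_Mapping.single (Free_Word xs) a \<in> carrier (free_alg_ring L)"
  by simp

lemma single_word_Cons:
  "Poly_Mapping.single (Free_Word (x # xs)) 1 = gen x * Poly_Mapping.single (Free_Word xs) 1"
  by (simp add: gen_def mult_single plus_free_word_def)

text \<open>Turning a scalar c into the element c 1 makes scaling a product in U, the form in which
  the relations of the tensor product express it.\<close>

lemma fscale_eq_mult: "fscale c f = fscale c 1 * (f :: 'l free_alg)"
proof -
  have "fscale c 1 = Poly_Mapping.single 0 c"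
    by (metis fscale_single mult.right_neutral single_one)
  then show ?thesis
    by (metis fscale_def mult_map_scale_conv_mult)
qed

lemma cls_fscale:
  "f \<in> carrier (free_alg_ring L) \<Longrightarrow> cls (fscale c f) = cls (fscale c 1) \<otimes>\<^bsub>U\<^esub> cls f"
  by (metis cls_simps(2) fscale_eq_mult free_alg_carrier_closed_unary(2) one_in_carrier)

lemma cls_gen_add: "x \<in> L \<Longrightarrow> y \<in> L \<Longrightarrow> cls (gen (x + y)) = cls (gen x) \<oplus>\<^bsub>U\<^esub> cls (gen y)"
proof -
  assume xy: "x \<in> L" "y \<in> L"
  then have "gen (x + y) - (gen x + gen y) \<in> I"
    using rels_in_I unfolding uea_rels_def diff_diff_add[symmetric] by blast
  then have "cls (gen (x + y)) = cls (gen x + gen y)"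
    using xy L_add by (intro cls_eqI free_alg_carrier_closed free_alg_carrier_closed_unary gen_in_carrier) auto
  then show ?thesis
    using xy by (simp only: cls_simps gen_in_carrier)
qed

lemma cls_gen_scale: "x \<in> L \<Longrightarrow> cls (gen (sc c x)) = cls (fscale c 1) \<otimes>\<^bsub>U\<^esub> cls (gen x)"
proof -
  assume x: "x \<in> L"
  then have "gen (sc c x) - fscale c (gen x) \<in> I"
    using rels_in_I unfolding uea_rels_def by blast
  then have "cls (gen (sc c x)) = cls (fscale c (gen x))"
    using x L_scale by (intro cls_eqI free_alg_carrier_closed free_alg_carrier_closed_unary gen_in_carrier) auto
  then show ?thesis
    using x by (simp only: cls_fscale gen_in_carrier)
qed

lemma gen_zero_in_I: "gen 0 \<in> I"
proof -
  interpret I: ideal I "free_alg_ring L" by (rule ideal_I)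
  \<comment> \<open>The scaling relation at c = 0 and x = 0 reduces to \<open>gen 0\<close>.\<close>
  have "gen (sc 0 0) - fscale 0 (gen 0) \<in> I"
    using rels_in_I subspace_0[OF subspace_L] unfolding uea_rels_def by blast
  then show ?thesis by simp
qed

lemma cls_gen_zero: "cls (gen 0) = cls 0"
  using gen_zero_in_I subspace_0[OF subspace_L] by (intro cls_eqI gen_in_carrier) simp_all

lemma cls_gen_commute:
  assumes "x \<in> L" "y \<in> L" "br x y = 0"
  shows "cls (gen x) \<otimes>\<^bsub>U\<^esub> cls (gen y) = cls (gen y) \<otimes>\<^bsub>U\<^esub> cls (gen x)"
proof -
  interpret I: ideal I "free_alg_ring L" by (rule ideal_I)
  have "gen x * gen y - gen y * gen x - gen (br x y) \<in> I"
    using rels_in_I assms unfolding uea_rels_def by blast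
  \<comment> \<open>Adding \<open>gen 0\<close>, an element of the ideal, cancels the bracket term,
    since br x y = 0.\<close>
  from additive_subgroup.a_closed[OF I.is_additive_subgroup this gen_zero_in_I]
  have "cls (gen x * gen y) = cls (gen y * gen x)"
    using assms by (intro cls_eqI free_alg_carrier_closed free_alg_carrier_closed_unary gen_in_carrier) auto
  then show ?thesis
    using assms by (simp only: cls_simps gen_in_carrier)
qed

text \<open>Classes of words span U, and a word is built by multiplying letters on the left. This
  matches the action of x on u \<otimes> m, which also multiplies u on the left.\<close>

lemma carrier_U_induct [consumes 1, case_names one gen scale add]:
  assumes u: "u \<in> carrier U"
    and one: "Q \<one>\<^bsub>U\<^esub>"
    and gen: "\<And>x u. x \<in> L \<Longrightarrow> u \<in> carrier U \<Longrightarrow> Q u \<Longrightarrow> Q (cls (gen x) \<otimes>\<^bsub>U\<^esub> u)"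
    and scale: "\<And>c u. u \<in> carrier U \<Longrightarrow> Q u \<Longrightarrow> Q (cls (fscale c 1) \<otimes>\<^bsub>U\<^esub> u)"
    and add: "\<And>u v. u \<in> carrier U \<Longrightarrow> v \<in> carrier U \<Longrightarrow> Q u \<Longrightarrow> Q v \<Longrightarrow> Q (u \<oplus>\<^bsub>U\<^esub> v)"
  shows "Q u"
proof -
  have word: "Q (cls (Poly_Mapping.single (Free_Word xs) 1))" if "set xs \<subseteq> L" for xs
    using that
  proof (induction xs)
    case Nil
    then show ?case
      using one by (simp add: zero_free_word_def[symmetric] cls_one)
  next
    case (Cons x xs)
    then have "x \<in> L" "set xs \<subseteq> L" "Q (cls (Poly_Mapping.single (Free_Word xs) 1))"
      by auto
    then show ?case
      unfolding single_word_Cons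
      by (subst cls_simps) (auto simp: carrier_U simp del: free_alg_ring_simps intro!: gen word_in_carrier)
  qed
  obtain f where f: "f \<in> carrier (free_alg_ring L)" "u = cls f"
    using u carrier_U by blast
  have "f \<in> carrier (free_alg_ring L) \<and> Q (cls f)"
  proof (induction f rule: poly_mapping_add_induct)
    case (single k)
    let ?w = "Poly_Mapping.single k 1"
    have k: "set (letters k) \<subseteq> L"
      using single f(1) by auto
    then have w: "?w \<in> carrier (free_alg_ring L)" "Q (cls ?w)"
      using word[of "letters k"] word_in_carrier[of "letters k" 1] by simp_all
    have "Poly_Mapping.single k (Poly_Mapping.lookup f k) = fscale (Poly_Mapping.lookup f k) ?w"
      by simp
    then show ?case
      using w scale[of "cls ?w"] cls_fscale[OF w(1)] free_alg_carrier_closed_unary(2)[OF w(1)]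
      by (metis carrier_U imageI)
  next
    case (add g h)
    then show ?case
      using free_alg_carrier_closed(1)[of g L h] assms(5)[of "cls g" "cls h"]
      by (metis carrier_U cls_simps(1) imageI)
  next
    case zero
    \<comment> \<open>The zero class is reached as the scalar 0 times the unit.\<close>
    have "cls 0 = cls (fscale 0 1) \<otimes>\<^bsub>U\<^esub> \<one>\<^bsub>U\<^esub>"
      using cls_fscale[OF one_in_carrier, of 0] by (simp add: cls_one)
    then show ?case
      using scale[of "\<one>\<^bsub>U\<^esub>" 0] one ring.ring_simprules(6)[OF ring_U] by simp
  qed
  then show ?thesis using f by simp
qed

lemma cls_in_carrier: "f \<in> carrier (free_alg_ring L) \<Longrightarrow> cls f \<in> carrier U"
  by (simp add: carrier_U del: free_alg_ring_simps)

lemma cls_scalar_commute: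
  assumes "u \<in> carrier U"
  shows "cls (fscale c 1) \<otimes>\<^bsub>U\<^esub> u = u \<otimes>\<^bsub>U\<^esub> cls (fscale c 1)"
proof -
  obtain f where f: "f \<in> carrier (free_alg_ring L)" "u = cls f"
    using assms carrier_U by blast
  have "fscale c 1 * f = f * fscale c 1"
  proof (induction f rule: poly_mapping_add_induct)
    case (single k)
    have "fscale c 1 = (Poly_Mapping.single 0 c :: 'l free_alg)"
      by (metis fscale_single mult.right_neutral single_one)
    then show ?case
      by (simp add: mult_single mult.commute)
  qed (simp_all add: algebra_simps)
  then show ?thesis
    using f free_alg_carrier_closed_unary(2)[OF one_in_carrier, of]
    by (metis cls_simps(2))
qed

text \<open>Centrality passes from generators to all of U. This serves to move a central element
  from the left of u to the right, where, if it lies in P, the tensor relation over U(P) hands it to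
  M.\<close>

lemma central_commute:
  assumes z: "z \<in> L" "\<And>x. x \<in> L \<Longrightarrow> br z x = 0" and u: "u \<in> carrier U"
  shows "cls (gen z) \<otimes>\<^bsub>U\<^esub> u = u \<otimes>\<^bsub>U\<^esub> cls (gen z)"
proof -
  interpret U: ring U by (rule ring_U)
  have zU: "cls (gen z) \<in> carrier U" and scU: "cls (fscale c 1) \<in> carrier U" for c
    using z(1) free_alg_carrier_closed_unary(2)[OF one_in_carrier]
    by (auto intro!: cls_in_carrier simp del: free_alg_ring_simps)
  show ?thesis
    using u
  proof (induction rule: carrier_U_induct)
    case (gen x u)
    have xU: "cls (gen x) \<in> carrier U" by (rule cls_in_carrier[OF gen_in_carrier[OF gen(1)]])
    show ?case
      using gen cls_gen_commute[OF z(1) gen(1) z(2)[OF gen(1)]] zU xU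
      by (metis U.m_assoc)
  next
    case (scale c u)
    then show ?case
      using cls_scalar_commute[OF zU, of c] zU scU[of c] by (metis U.m_assoc)
  qed (use zU in \<open>simp_all add: U.l_distr U.r_distr\<close>)
qed

end

section \<open>Cosets of a subspace and operations on representatives\<close>

lemma vs_coset_eq_iff:
  assumes "fscale.subspace R"
  shows "vs_coset R f = vs_coset R g \<longleftrightarrow> f - g \<in> R"
proof
  assume "vs_coset R f = vs_coset R g"
  moreover have "f \<in> vs_coset R f"
    using fscale.subspace_0[OF assms] by (force simp: vs_coset_def)
  ultimately show "f - g \<in> R"
    by (auto simp: vs_coset_def)
next
  have *: "vs_coset R f \<subseteq> vs_coset R g" if "f - g \<in> R" for f g
  proof
    fix x assume "x \<in> vs_coset R f"
    then have "x - f \<in> R" by (auto simp: vs_coset_def)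
    from fscale.subspace_add[OF assms this that] show "x \<in> vs_coset R g"
      by (force simp: vs_coset_def intro: exI[of _ "x - g"])
  qed
  assume "f - g \<in> R"
  with fscale.subspace_neg[OF assms this] show "vs_coset R f = vs_coset R g"
    using *[of f g] *[of g f] by simp
qed

text \<open>All the cosets in the union coincide, because shifts by R change \<phi> by elements of
  R. Thus the operations of \<open>quotient_space\<close>, which are defined as unions, can be
  computed on representatives.\<close>

lemma vs_coset_UN:
  assumes R: "fscale.subspace R" and \<phi>: "\<And>h. h \<in> R \<Longrightarrow> \<phi> (f + h) - \<phi> f \<in> R"
  shows "(\<Union>g\<in>vs_coset R f. vs_coset R (\<phi> g)) = vs_coset R (\<phi> f)"
proof -
  have "vs_coset R (\<phi> g) = vs_coset R (\<phi> f)" if "g \<in> vs_coset R f" for g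
    using that \<phi> by (auto simp: vs_coset_def[of R f] vs_coset_eq_iff[OF R])
  moreover have "f \<in> vs_coset R f"
    using fscale.subspace_0[OF R] by (force simp: vs_coset_def)
  ultimately show ?thesis by blast
qed

section \<open>Generation of the induced module\<close>

context lie_induced
begin

lemma subspace_K: "fscale.subspace K"
  unfolding tensor_ker_def by (rule fscale.subspace_span)

lemma rels_K: "rels \<subseteq> K"
  unfolding tensor_ker_def by (rule fscale.span_superset)

text \<open>Everything is reached from the vectors 1 \<otimes> m by left multiplications with
  elements of L. Closure is assumed for G; for z in C it follows from (z u) \<otimes> m = (u z)
  \<otimes> m = u \<otimes> (z m).\<close>

lemma tensor_induct:
  assumes T: "fscale.subspace T" "K \<subseteq> T"
    and one: "\<And>m. pure_tensor \<one>\<^bsub>U\<^esub> m \<in> T"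
    and L_span: "L \<subseteq> span (G \<union> C)"
    and G: "G \<subseteq> L" "\<And>x u m. x \<in> G \<Longrightarrow> u \<in> carrier U \<Longrightarrow> pure_tensor u m \<in> T \<Longrightarrow>
      pure_tensor (cls (gen x) \<otimes>\<^bsub>U\<^esub> u) m \<in> T"
    and C: "C \<subseteq> P" "\<And>z x. z \<in> C \<Longrightarrow> x \<in> L \<Longrightarrow> br z x = 0"
    and f: "fst ` Poly_Mapping.keys f \<subseteq> carrier U"
  shows "f \<in> T"
proof -
  interpret U: ring U by (rule ring_U)
  note T_simps = fscale.subspace_add[OF T(1)] fscale.subspace_scale[OF T(1)] fscale.subspace_0[OF T(1)]
  have T_diff: "g \<in> T" if "f - g \<in> rels" "f \<in> T" for f g
    using fscale.subspace_diff[OF T(1) that(2)] that(1) rels_K T(2) by fastforce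
  have T_rels: "f \<in> T" if "f - g \<in> rels" "g \<in> T" for f g
    using fscale.subspace_add[OF T(1) _ that(2)] that(1) rels_K T(2) by fastforce
  have add_left: "pure_tensor (u \<oplus>\<^bsub>U\<^esub> v) m \<in> T"
    if "u \<in> carrier U" "v \<in> carrier U" "pure_tensor u m \<in> T" "pure_tensor v m \<in> T" for u v m
  proof (rule T_rels)
    show "pure_tensor (u \<oplus>\<^bsub>U\<^esub> v) m - (pure_tensor u m + pure_tensor v m) \<in> rels"
      using that(1,2) unfolding tensor_rels_def Let_def diff_diff_add[symmetric] by blast
  qed (use that T_simps in blast)
  have scale_left: "pure_tensor (cls (fscale c 1) \<otimes>\<^bsub>U\<^esub> u) m \<in> T"
    if "u \<in> carrier U" "pure_tensor u m \<in> T" for c u m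
  proof (rule T_rels)
    show "pure_tensor (cls (fscale c 1) \<otimes>\<^bsub>U\<^esub> u) m - fscale c (pure_tensor u m) \<in> rels"
      using that(1) unfolding tensor_rels_def Let_def by blast
  qed (use that T_simps in blast)
  have genU: "cls (gen x) \<in> carrier U" if "x \<in> L" for x
    by (rule cls_in_carrier[OF gen_in_carrier[OF that]])
  have scU: "cls (fscale c 1) \<in> carrier U" for c
    by (rule cls_in_carrier[OF free_alg_carrier_closed_unary(2)[OF one_in_carrier]])
  \<comment> \<open>\<open>uT\<close> is assumed for every m because a central z replaces m by
    another vector of M.\<close>
  have gen_left: "pure_tensor (cls (gen x) \<otimes>\<^bsub>U\<^esub> u) m \<in> T"
    if x: "x \<in> L" and u: "u \<in> carrier U" and uT: "\<And>m. pure_tensor u m \<in> T" for x u m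
  proof -
    \<comment> \<open>The condition is linear in x, so it suffices that this subspace contains G and
      C.\<close>
    let ?S = "{x \<in> L. pure_tensor (cls (gen x) \<otimes>\<^bsub>U\<^esub> u) m \<in> T}"
    have "subspace ?S"
    proof (rule subspaceI)
      show "0 \<in> ?S"
        using scale_left[OF u uT, of 0 m] subspace_0[OF subspace_L] cls_gen_zero by simp
    next
      fix x y assume "x \<in> ?S" "y \<in> ?S"
      then show "x + y \<in> ?S"
        using u genU by (auto simp: L_add cls_gen_add U.l_distr intro!: add_left)
    next
      fix c x assume "x \<in> ?S"
      then show "sc c x \<in> ?S"
        using u genU scU by (auto simp: L_scale cls_gen_scale U.m_assoc intro!: scale_left)
    qed
    moreover have "G \<subseteq> ?S"
      using G u uT by blast
    moreover have "C \<subseteq> ?S"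
    proof
      fix z assume z: "z \<in> C"
      then have zP: "z \<in> P" "z \<in> L" using C(1) P_L by auto
      \<comment> \<open>A word of one letter acts as that letter; its coefficient 1 disappears by
        \<open>scaleM_one\<close>.\<close>
      have "free_alg_act scaleM \<rho> (gen z) m = \<rho> z m"
        by (simp add: free_alg_act_def lin_ext_def gen_def scaleM_one)
      moreover have "pure_tensor (u \<otimes>\<^bsub>U\<^esub> cls (gen z)) m
          - pure_tensor u (free_alg_act scaleM \<rho> (gen z) m) \<in> rels"
        using u gen_in_carrier[OF zP(1)] unfolding tensor_rels_def Let_def by blast
      ultimately have "pure_tensor (u \<otimes>\<^bsub>U\<^esub> cls (gen z)) m \<in> T"
        using T_rels uT by metis
      then show "z \<in> ?S"
        using central_commute[OF zP(2) C(2)[OF z] u] zP(2) by simp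
    qed
    ultimately have "span (G \<union> C) \<subseteq> ?S"
      by (intro span_minimal) auto
    then show ?thesis
      using x L_span by blast
  qed
  have pure: "\<forall>m. pure_tensor u m \<in> T" if "u \<in> carrier U" for u
    using that
    by (induction rule: carrier_U_induct) (auto intro: one add_left scale_left gen_left)
  show ?thesis
  proof (induction f rule: poly_mapping_add_induct)
    case (single k)
    then have "fst k \<in> carrier U"
      using f by auto
    then have "pure_tensor (fst k) (snd k) \<in> T"
      using pure by blast
    from fscale.subspace_scale[OF T(1) this, of "Poly_Mapping.lookup f k"]
    show ?case by simp
  qed (use T_simps in blast)+
qed

lemma V_add: "vs_coset K f \<oplus>\<^bsub>V\<^esub> vs_coset K g = vs_coset K (f + g)"
proof -
  have "(\<Union>g'\<in>vs_coset K g. vs_coset K (f' + g')) = vs_coset K (f' + g)" for f'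
    by (rule vs_coset_UN[OF subspace_K, where \<phi> = "\<lambda>g. f' + g"]) simp
  moreover have "(\<Union>f'\<in>vs_coset K f. vs_coset K (f' + g)) = vs_coset K (f + g)"
    by (rule vs_coset_UN[OF subspace_K, where \<phi> = "\<lambda>f. f + g"]) simp
  ultimately show ?thesis
    by (simp add: induced_module_def quotient_space_def)
qed

lemma V_smult: "c \<odot>\<^bsub>V\<^esub> vs_coset K f = vs_coset K (fscale c f)"
  using vs_coset_UN[OF subspace_K, where \<phi> = "fscale c" and f = f] fscale.subspace_scale[OF subspace_K]
  by (simp add: induced_module_def quotient_space_def coset_lift_def fscale.scale_right_distrib)

lemma carrier_V: "carrier V = vs_coset K ` {f. fst ` Poly_Mapping.keys f \<subseteq> carrier U}"
  by (simp add: induced_module_def quotient_space_def)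

abbreviation "emb \<equiv> induced_emb sc br L P scaleM \<rho>"
abbreviation "act \<equiv> induced_act sc br L P scaleM \<rho>"

lemma emb_carrier: "emb m \<in> carrier V"
  using ring.ring_simprules(6)[OF ring_U] by (simp add: carrier_V induced_emb_def)

lemma emb_add: "emb (m + m') = emb m \<oplus>\<^bsub>V\<^esub> emb m'"
proof -
  have "pure_tensor \<one>\<^bsub>U\<^esub> (m + m') - pure_tensor \<one>\<^bsub>U\<^esub> m - pure_tensor \<one>\<^bsub>U\<^esub> m' \<in> rels"
    using ring.ring_simprules(6)[OF ring_U] unfolding tensor_rels_def Let_def by blast
  then show ?thesis
    using rels_K by (simp add: induced_emb_def V_add vs_coset_eq_iff[OF subspace_K] diff_diff_add subset_iff)
qed

lemma emb_scale: "emb (scaleM c m) = c \<odot>\<^bsub>V\<^esub> emb m"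
proof -
  have "pure_tensor \<one>\<^bsub>U\<^esub> (scaleM c m) - fscale c (pure_tensor \<one>\<^bsub>U\<^esub> m) \<in> rels"
    using ring.ring_simprules(6)[OF ring_U] unfolding tensor_rels_def Let_def by blast
  then show ?thesis
    using rels_K by (auto simp: induced_emb_def V_smult vs_coset_eq_iff[OF subspace_K])
qed

text \<open>Assuming that the result is a coset at all spares the proof that the action preserves
  \<^term>\<open>K\<close>.\<close>

lemma act_pure_tensor:
  assumes "act x (vs_coset K (pure_tensor u m)) \<in> carrier V"
  shows "act x (vs_coset K (pure_tensor u m)) =
    vs_coset K (pure_tensor (cls (gen x) \<otimes>\<^bsub>U\<^esub> u) m)"
proof -
  let ?\<phi> = "lin_ext fscale (\<lambda>(u, m). pure_tensor (cls (gen x) \<otimes>\<^bsub>U\<^esub> u) m)"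
  let ?p = "pure_tensor u m" and ?q = "pure_tensor (cls (gen x) \<otimes>\<^bsub>U\<^esub> u) m"
  have mem: "f \<in> vs_coset K f" for f
    using fscale.subspace_0[OF subspace_K] by (force simp: vs_coset_def)
  obtain f where f: "act x (vs_coset K ?p) = vs_coset K f"
    using assms unfolding carrier_V by blast
  have "?q = ?\<phi> ?p"
    by (simp add: lin_ext_def)
  moreover have "vs_coset K (?\<phi> ?p) \<subseteq> act x (vs_coset K ?p)"
    using mem unfolding induced_act_def coset_lift_def by blast
  ultimately have "?q \<in> vs_coset K f"
    using mem f by auto
  then have "?q - f \<in> K"
    by (auto simp: vs_coset_def)
  then show ?thesis
    using f vs_coset_eq_iff[OF subspace_K] by blast
qed

text \<open>T is pulled back to a subspace of pre-tensors that contains \<open>K\<close>, to which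
  \<open>tensor_induct\<close> applies.\<close>

lemma V_induct:
  assumes T: "T \<subseteq> carrier V"
    and add: "\<And>v w. v \<in> T \<Longrightarrow> w \<in> T \<Longrightarrow> v \<oplus>\<^bsub>V\<^esub> w \<in> T"
    and scale: "\<And>c v. v \<in> T \<Longrightarrow> c \<odot>\<^bsub>V\<^esub> v \<in> T"
    and emb: "\<And>m. emb m \<in> T"
    and L_span: "L \<subseteq> span (G \<union> C)"
    and G: "G \<subseteq> L" "\<And>x v. x \<in> G \<Longrightarrow> v \<in> T \<Longrightarrow> act x v \<in> T"
    and C: "C \<subseteq> P" "\<And>z x. z \<in> C \<Longrightarrow> x \<in> L \<Longrightarrow> br z x = 0"
  shows "carrier V = T"
proof -
  let ?T = "{f. vs_coset K f \<in> T}"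
  \<comment> \<open>The zero coset is 0 times any embedded vector, whence the arbitrary
    \<open>undefined\<close>.\<close>
  have "vs_coset K 0 \<in> T"
    using scale[OF emb, of 0 undefined] by (simp add: induced_emb_def V_smult)
  then have sub: "fscale.subspace ?T"
    using add scale unfolding V_add[symmetric] V_smult[symmetric]
    by (intro fscale.subspaceI) (simp_all add: V_add[symmetric] V_smult[symmetric])
  have "vs_coset K f = vs_coset K 0" if "f \<in> K" for f
    using that by (simp add: vs_coset_eq_iff[OF subspace_K])
  then have K: "K \<subseteq> ?T"
    using \<open>vs_coset K 0 \<in> T\<close> by auto
  have "f \<in> ?T" if "fst ` Poly_Mapping.keys f \<subseteq> carrier U" for f
  proof (rule tensor_induct[OF sub K _ L_span G(1) _ C that])
    show "pure_tensor \<one>\<^bsub>U\<^esub> m \<in> ?T" for m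
      using emb by (simp add: induced_emb_def)
    \<comment> \<open>T lies in the carrier, so closure under the action of G supplies the
      hypothesis of \<open>act_pure_tensor\<close>.\<close>
    show "pure_tensor (cls (gen x) \<otimes>\<^bsub>U\<^esub> u) m \<in> ?T"
      if "x \<in> G" "pure_tensor u m \<in> ?T" for x u m
      using act_pure_tensor[of x u m] G(2)[of x "vs_coset K (pure_tensor u m)"] that T by auto
  qed
  then show ?thesis
    using T by (auto simp: carrier_V)
qed

end

section \<open>Commuting operators of finite order and traces\<close>

text \<open>The projector to the eigenvalue \<omega>^k when \<sigma>^N = id and \<omega> is a
  primitive N-th root of unity: the average of \<omega>^(-k n) \<sigma>^n over n.\<close>

definition eigen_proj ::
  "('a::field \<Rightarrow> 'b::ab_group_add \<Rightarrow> 'b) \<Rightarrow> ('b \<Rightarrow> 'b) \<Rightarrow> nat \<Rightarrow> 'a \<Rightarrow> nat \<Rightarrow> 'b \<Rightarrow> 'b" where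
  "eigen_proj sc \<sigma> N \<omega> k x =
     sc (inverse (of_nat N)) (\<Sum>n<N. sc (inverse \<omega> ^ (k * n)) ((\<sigma> ^^ n) x))"

context vector_space
begin

lemma eigen_proj_eigen:
  assumes \<sigma>: "Vector_Spaces.linear scale scale \<sigma>" "\<sigma> ^^ N = id" and \<omega>: "\<omega> ^ N = 1" "0 < N"
  shows "\<sigma> (eigen_proj scale \<sigma> N \<omega> k x) = scale (\<omega> ^ k) (eigen_proj scale \<sigma> N \<omega> k x)"
proof -
  interpret \<sigma>: Vector_Spaces.linear scale scale \<sigma> by fact
  define f where "f n = scale (inverse \<omega> ^ (k * n)) ((\<sigma> ^^ n) x)" for n
  have "\<omega> \<noteq> 0" using \<omega> by (auto simp: zero_power)
  then have "\<omega> ^ k * inverse \<omega> ^ (k * Suc n) = inverse \<omega> ^ (k * n)" for n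
    by (simp add: power_add field_simps)
  then have \<sigma>f: "\<sigma> (f n) = scale (\<omega> ^ k) (f (Suc n))" for n
    by (simp add: f_def \<sigma>.scale)
  \<comment> \<open>Applying \<sigma> shifts the summation index by one; since \<sigma>^N = id and
    \<omega>^N = 1, the term at N equals the term at 0 and the sum is unchanged.\<close>
  have "inverse \<omega> ^ (k * N) = 1"
    using \<omega> by (simp add: mult.commute[of k] power_mult power_inverse)
  then have "f N = f 0"
    using \<sigma>(2) by (simp add: f_def)
  then have "(\<Sum>n<N. f (Suc n)) = (\<Sum>n<N. f n)"
    using sum.lessThan_Suc[of f N] sum.lessThan_Suc_shift[of f N] by simp
  then have "\<sigma> (\<Sum>n<N. f n) = scale (\<omega> ^ k) (\<Sum>n<N. f n)"
    by (simp add: \<sigma>.sum \<sigma>f scale_sum_right[symmetric])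
  then show ?thesis
    unfolding eigen_proj_def f_def[symmetric] by (simp add: \<sigma>.scale mult.commute)
qed

text \<open>With \<open>eigen_proj_scale\<close> this shows that the projection of an eigenvector of
  a commuting operator \<tau> satisfies the same eigenvalue equation.\<close>

lemma eigen_proj_commute:
  assumes \<tau>: "Vector_Spaces.linear scale scale \<tau>" "\<tau> \<circ> \<sigma> = \<sigma> \<circ> \<tau>"
  shows "\<tau> (eigen_proj scale \<sigma> N \<omega> k x) = eigen_proj scale \<sigma> N \<omega> k (\<tau> x)"
proof -
  interpret \<tau>: Vector_Spaces.linear scale scale \<tau> by fact
  have "\<tau> ((\<sigma> ^^ n) x) = (\<sigma> ^^ n) (\<tau> x)" for n
    using \<tau>(2) by (induction n) (auto simp: fun_eq_iff)
  then show ?thesis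
    by (simp add: eigen_proj_def \<tau>.scale \<tau>.sum)
qed

lemma eigen_proj_scale:
  assumes "Vector_Spaces.linear scale scale \<sigma>"
  shows "eigen_proj scale \<sigma> N \<omega> k (scale c x) = scale c (eigen_proj scale \<sigma> N \<omega> k x)"
proof -
  interpret \<sigma>: Vector_Spaces.linear scale scale \<sigma> by fact
  have "(\<sigma> ^^ n) (scale c x) = scale c ((\<sigma> ^^ n) x)" for n
    by (induction n) (auto simp: \<sigma>.scale)
  then show ?thesis
    by (simp add: eigen_proj_def scale_sum_right mult.commute mult.left_commute)
qed

end

text \<open>Orthogonality of characters: summing over k, the coefficient of \<sigma>^n becomes a
  geometric sum, which is 0 for 0 < n < N and N for n = 0.\<close>

lemma (in vector_space) sum_eigen_proj:
  assumes N: "0 < N" "of_nat N \<noteq> (0 :: 'a)" and \<omega>: "\<omega> ^ N = 1" "\<And>n. 0 < n \<Longrightarrow> n < N \<Longrightarrow> \<omega> ^ n \<noteq> 1"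
  shows "(\<Sum>k<N. eigen_proj scale \<sigma> N \<omega> k x) = x"
proof -
  have sum: "(\<Sum>k<N. inverse \<omega> ^ (k * n)) = (if n = 0 then of_nat N else 0)" if "n < N" for n
  proof (cases "n = 0")
    case False
    have "inverse \<omega> ^ n \<noteq> 1"
      using \<omega>(2)[of n] that False by (simp add: power_inverse)
    moreover have "(inverse \<omega> ^ n) ^ N = 1"
      using \<omega>(1) by (metis inverse_1 mult.commute power_inverse power_mult power_one)
    ultimately have "(\<Sum>k<N. (inverse \<omega> ^ n) ^ k) = 0"
      by (simp add: sum_gp_strict)
    then show ?thesis
      using False by (simp add: power_mult[symmetric] mult.commute)
  qed simp
  have "(\<Sum>k<N. \<Sum>n<N. scale (inverse \<omega> ^ (k * n)) ((\<sigma> ^^ n) x))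
      = (\<Sum>n<N. scale (\<Sum>k<N. inverse \<omega> ^ (k * n)) ((\<sigma> ^^ n) x))"
    by (subst sum.swap) (simp add: scale_sum_left)
  also have "\<dots> = (\<Sum>n<N. if n = 0 then scale (of_nat N) x else 0)"
    by (intro sum.cong) (auto simp: sum)
  also have "\<dots> = scale (of_nat N) x"
    using N by simp
  finally show ?thesis
    using N by (simp add: eigen_proj_def scale_sum_right[symmetric])
qed

text \<open>Induction on the set of operators. A simultaneous eigenvector for J is the sum of its
  projections for \<open>\<sigma> j\<close>, and these remain eigenvectors for J since the operators
  commute.\<close>

lemma (in vector_space) span_simultaneous_eigen:
  fixes \<sigma> :: "'i \<Rightarrow> 'b \<Rightarrow> 'b" and N :: "'i \<Rightarrow> nat" and \<omega> :: "'i \<Rightarrow> 'a"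
  assumes "finite J"
    and \<sigma>: "\<And>i. Vector_Spaces.linear scale scale (\<sigma> i)" "\<And>i. \<sigma> i ^^ N i = id"
      "\<And>i j. \<sigma> i \<circ> \<sigma> j = \<sigma> j \<circ> \<sigma> i"
    and N: "\<And>i. 0 < N i" "\<And>i. of_nat (N i) \<noteq> (0 :: 'a)"
    and \<omega>: "\<And>i. \<omega> i ^ N i = 1" "\<And>i n. 0 < n \<Longrightarrow> n < N i \<Longrightarrow> \<omega> i ^ n \<noteq> 1"
  shows "x \<in> span {x. \<forall>i\<in>J. \<exists>k. \<sigma> i x = scale (\<omega> i ^ k) x}"
  using \<open>finite J\<close>
proof (induction J arbitrary: x rule: finite_induct)
  case empty
  then show ?case by simp
next
  case (insert j J)
  let ?E = "\<lambda>J. {x. \<forall>i\<in>J. \<exists>k. \<sigma> i x = scale (\<omega> i ^ k) x}"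
  have "y \<in> span (?E (insert j J))" if y: "y \<in> ?E J" for y
  proof -
    have "eigen_proj scale (\<sigma> j) (N j) (\<omega> j) k y \<in> ?E (insert j J)" for k
    proof -
      have "\<exists>k'. \<sigma> i (eigen_proj scale (\<sigma> j) (N j) (\<omega> j) k y)
          = scale (\<omega> i ^ k') (eigen_proj scale (\<sigma> j) (N j) (\<omega> j) k y)" if i: "i \<in> J" for i
      proof -
        obtain k' where "\<sigma> i y = scale (\<omega> i ^ k') y"
          using y i by blast
        then show ?thesis
          unfolding eigen_proj_commute[OF \<sigma>(1,3)]
          by (simp only: eigen_proj_scale[OF \<sigma>(1)]) (rule exI, rule refl)
      qed
      then show ?thesis
        using eigen_proj_eigen[OF \<sigma>(1,2) \<omega>(1) N(1)] by blast
    qed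
    then have "(\<Sum>k<N j. eigen_proj scale (\<sigma> j) (N j) (\<omega> j) k y) \<in> span (?E (insert j J))"
      by (intro span_sum span_base)
    then show ?thesis
      by (simp add: sum_eigen_proj N \<omega>)
  qed
  then have "span (?E J) \<subseteq> span (?E (insert j J))"
    by (intro span_minimal) auto
  then show ?case
    using insert.IH by blast
qed

section \<open>Traces and invariance of the Killing form\<close>

lemma (in finite_dimensional_vector_space) trace_commute:
  assumes f: "Vector_Spaces.linear scale scale f" and g: "Vector_Spaces.linear scale scale g"
  shows "(\<Sum>b\<in>Basis. representation Basis (f (g b)) b) = (\<Sum>b\<in>Basis. representation Basis (g (f b)) b)"
proof -
  \<comment> \<open>Diagonal entries of a matrix product; exchanging the two summations then makes
    the trace symmetric in f and g.\<close>
  have expand: "representation Basis (f (g b)) b =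
      (\<Sum>c\<in>Basis. representation Basis (g b) c * representation Basis (f c) b)"
    if "Vector_Spaces.linear scale scale f" for f g :: "'b \<Rightarrow> 'b" and b
  proof -
    interpret f: Vector_Spaces.linear scale scale f by fact
    have "f (g b) = f (\<Sum>c\<in>Basis. scale (representation Basis (g b) c) c)"
      by (simp add: sum_representation_eq independent_Basis span_Basis finite_Basis)
    also have "\<dots> = (\<Sum>c\<in>Basis. scale (representation Basis (g b) c) (f c))"
      by (simp add: f.sum f.scale)
    finally show ?thesis
      by (simp add: representation_sum representation_scale independent_Basis span_Basis)
  qed
  show ?thesis
    unfolding expand[OF f, of g] expand[OF g, of f] by (subst sum.swap) (simp add: mult.commute)
qed

lemma lin_trace_commute:
  assumes "\<exists>B. finite_dimensional_vector_space sc B"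
    and "Vector_Spaces.linear sc sc f" "Vector_Spaces.linear sc sc g"
  shows "lin_trace sc (f \<circ> g) = lin_trace sc (g \<circ> f)"
proof -
  have "finite_dimensional_vector_space sc (SOME B. finite_dimensional_vector_space sc B)"
    using assms(1) by (rule someI_ex)
  from finite_dimensional_vector_space.trace_commute[OF this assms(2,3)]
  show ?thesis by (simp add: lin_trace_def Let_def)
qed

lemma killing_form_invariant:
  assumes "fd_simple_lie_algebra sc br" "lie_automorphism sc br \<sigma>"
  shows "killing_form sc br (\<sigma> x) (\<sigma> y) = killing_form sc br x y"
proof -
  note \<sigma> = assms(2)[unfolded lie_automorphism_def, THEN conjunct1]
    assms(2)[unfolded lie_automorphism_def, THEN conjunct2, THEN conjunct1]
    assms(2)[unfolded lie_automorphism_def, THEN conjunct2, THEN conjunct2, rule_format]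
  interpret fd_simple_lie_algebra sc br by fact
  have inv: "\<sigma> (finv \<sigma> z) = z" "finv \<sigma> (\<sigma> z) = z" for z
    using \<sigma>(2) by (simp_all add: bij_is_surj bij_is_inj surj_f_inv_f)
  have lin_inv: "Vector_Spaces.linear sc sc (finv \<sigma>)"
  proof -
    interpret \<sigma>: Vector_Spaces.linear sc sc \<sigma> by (rule \<sigma>(1))
    have "finv \<sigma> (u + v) = finv \<sigma> u + finv \<sigma> v" for u v
      by (rule inj_onD[OF bij_is_inj[OF \<sigma>(2)]]) (simp_all add: inv \<sigma>.add)
    moreover have "finv \<sigma> (sc c u) = sc c (finv \<sigma> u)" for u c
      by (rule inj_onD[OF bij_is_inj[OF \<sigma>(2)]]) (simp_all add: inv \<sigma>.scale)
    ultimately show ?thesis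
      by unfold_locales
  qed
  have "Vector_Spaces.linear sc sc (\<sigma> \<circ> (br x \<circ> br y))"
    by (intro Vector_Spaces.linear_compose[OF _ \<sigma>(1)]
        Vector_Spaces.linear_compose[OF br_linear_right br_linear_right])
  from lin_trace_commute[OF finite_dim this lin_inv]
  have "lin_trace sc ((\<sigma> \<circ> (br x \<circ> br y)) \<circ> finv \<sigma>) = lin_trace sc (finv \<sigma> \<circ> (\<sigma> \<circ> (br x \<circ> br y)))"
    .
  \<comment> \<open>Since \<sigma> respects the bracket, ad (\<sigma> x) is the conjugate of ad x by
    \<sigma>, and the inner factors of the product cancel.\<close>
  moreover have "br (\<sigma> x) \<circ> br (\<sigma> y) = (\<sigma> \<circ> (br x \<circ> br y)) \<circ> finv \<sigma>"
    by (simp add: fun_eq_iff \<sigma>(3) inv)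
  moreover have "finv \<sigma> \<circ> (\<sigma> \<circ> (br x \<circ> br y)) = br x \<circ> br y"
    by (simp add: fun_eq_iff inv)
  ultimately show ?thesis
    by (simp only: killing_form_def)
qed

lemma primitive_root_of_unity:
  assumes "0 < N"
  defines "\<omega> \<equiv> exp (2 * of_real pi * \<i> / of_nat N)"
  shows "\<omega> ^ N = 1" "0 < n \<Longrightarrow> n < N \<Longrightarrow> \<omega> ^ n \<noteq> 1"
proof -
  have \<omega>: "\<omega> ^ n = cis (2 * pi * real n / real N)" for n
  proof -
    have "\<omega> = cis (2 * pi / real N)"
      by (simp add: \<omega>_def cis_conv_exp mult.commute mult.left_commute)
    then show ?thesis
      by (simp add: DeMoivre mult.commute)
  qed
  note bij = bij_betw_roots_unity[OF assms(1)]
  show "\<omega> ^ N = 1"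
    using assms(1) by (simp add: \<omega> cis_2pi)
  \<comment> \<open>Distinct exponents below N give distinct roots of unity; n is compared with
    0.\<close>
  show "\<omega> ^ n \<noteq> 1" if "0 < n" "n < N"
    using inj_onD[OF bij_betw_imp_inj_on[OF bij], of n 0] that by (auto simp: \<omega>)
qed

section \<open>Modes of a toroidal vertex algebra\<close>

text \<open>For n > 0, (x - z)^(n - 1) is a polynomial of degree n - 1 in z, so z^n does not occur.
  This removes all terms but one from the residue of the third delta function.\<close>

lemma gbinomial_pred: "0 < n \<Longrightarrow> (of_int (int n - 1) :: complex) gchoose n = 0"
proof -
  assume "0 < n"
  then have "(of_int (int n - 1) :: complex) = of_nat (n - 1)" by simp
  then show ?thesis
    using \<open>0 < n\<close> by (simp add: binomial_gbinomial[symmetric] binomial_eq_0 del: of_nat_diff)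
qed

lemma complex_ring_simps [simp]:
  "carrier complex_ring = UNIV" "monoid.one complex_ring = 1" "monoid.mult complex_ring = (*)"
  "ring.zero complex_ring = 0" "add complex_ring = (+)"
  by (auto simp: ring_of_type_algebra_def)

lemma linear_endoD:
  assumes "linear_endo V f" "v \<in> carrier V"
  shows "f v \<in> carrier V"
    and "w \<in> carrier V \<Longrightarrow> f (v \<oplus>\<^bsub>V\<^esub> w) = f v \<oplus>\<^bsub>V\<^esub> f w"
    and "f (c \<odot>\<^bsub>V\<^esub> v) = c \<odot>\<^bsub>V\<^esub> f v"
  using assms funcset_mem[of f "carrier V" "carrier V" v] by (simp_all add: linear_endo_def)

locale complex_module = module complex_ring V for V :: "(complex, 'v, 'b) module_scheme" (structure)
begin

lemma smult_zero_complex: "v \<in> carrier V \<Longrightarrow> 0 \<odot> v = \<zero>"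
  using smult_l_null[of v] by simp

lemma smult_one_complex: "v \<in> carrier V \<Longrightarrow> 1 \<odot> v = v"
  using smult_one[of v] by simp

lemma smult_carrier: "v \<in> carrier V \<Longrightarrow> c \<odot> v \<in> carrier V"
  by simp

lemma linear_endo_zero: "linear_endo V f \<Longrightarrow> f \<zero> = \<zero>"
  using linear_endoD(3)[of V f \<zero> 0] linear_endoD(1)[of V f \<zero>] 
  by (simp add: smult_zero_complex)

lemma linear_endo_minus:
  assumes f: "linear_endo V f" and vw: "v \<in> carrier V" "w \<in> carrier V"
  shows "f (v \<ominus> w) = f v \<ominus> f w"
proof -
  have "f w \<oplus> f (\<ominus> w) = \<zero>"
    using linear_endoD(2)[OF f vw(2) a_inv_closed[OF vw(2)]]
    unfolding r_neg[OF vw(2)] linear_endo_zero[OF f] by (rule sym)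
  then have "f (\<ominus> w) = \<ominus> f w"
    using vw linear_endoD(1)[OF f] by (metis a_inv_closed minus_equality a_comm)
  then show ?thesis
    using linear_endoD(2)[OF f vw(1) a_inv_closed[OF vw(2)]] by (simp only: a_minus_def)
qed

lemma linear_endo_finsum:
  assumes f: "linear_endo V f" and g: "\<And>k. g k \<in> carrier V"
  shows "f (finsum V g A) = finsum V (\<lambda>k. f (g k)) A"
proof (induction A rule: infinite_finite_induct)
  case (insert k A)
  have "finsum V g A \<in> carrier V"
    by (rule finsum_closed) (use g in auto)
  then show ?case
    using insert linear_endoD(2)[OF f g, of "finsum V g A" k] linear_endoD(1)[OF f g] g
    by (simp add: Pi_def)
qed (use linear_endo_zero[OF f] in auto)

text \<open>Injectivity preserves the support over which \<open>supp_sum\<close> sums. On an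
  infinite support both sides are zero by the convention of \<open>finsum\<close>.\<close>

lemma linear_endo_supp_sum:
  assumes f: "linear_endo V f" "inj_on f (carrier V)" and g: "\<And>k. g k \<in> carrier V"
  shows "f (supp_sum V g) = supp_sum V (\<lambda>k. f (g k))"
proof -
  have "f (g k) = \<zero> \<longleftrightarrow> g k = \<zero>" for k
    using inj_onD[OF f(2), of "g k" \<zero>] linear_endo_zero[OF f(1)] g by auto
  then show ?thesis
    by (simp add: supp_sum_def linear_endo_finsum[OF f(1) g])
qed

lemma supp_sum_closed: "(\<And>k. g k \<in> carrier V) \<Longrightarrow> supp_sum V g \<in> carrier V"
  unfolding supp_sum_def by (rule finsum_closed) auto

end

sublocale toroidal_vertex_algebra \<subseteq> complex_module V
  by unfold_locales

context toroidal_vertex_algebra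
begin

lemma Y_closed: "u \<in> carrier V \<Longrightarrow> v \<in> carrier V \<Longrightarrow> Y u m0 m v \<in> carrier V"
  using linear_endoD(1)[OF linear_right] .

text \<open>The residue in \<open>x\<^sub>0\<close> of the Jacobi identity expresses the modes of \<open>Y(u) v\<close> by products of
  modes of \<open>u\<close> and \<open>v\<close>.\<close>

lemma iterate_formula:
  assumes "u \<in> carrier V" "v \<in> carrier V" "w \<in> carrier V"
  shows "Y (Y u n m v) q p w =
    supp_sum V (\<lambda>(i, j). delta_xy (- n - 1) i j \<odot> Y u i m (Y v (q + j) (p - m) w))
    \<ominus> supp_sum V (\<lambda>(i, j). delta_yx (- n - 1) i j \<odot> Y v (q + j) (p - m) (Y u i m w))"
proof -
  let ?f = "\<lambda>(h, j). delta_xz h (- 1) j \<odot> Y (Y u (n + h) m v) (q + j) p w"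
  \<comment> \<open>The exponent -1 of x_0 forces j = -h, and for h > 0 the coefficient is a
    multiple of (h - 1 choose h) = 0, so only h = j = 0 survives.\<close>
  have delta: "delta_xz h (- 1) j = (if h = 0 \<and> j = 0 then 1 else 0)" for h j
    using gbinomial_pred[of "nat h"] by (auto simp: delta_xz_def binom_coeff_def)
  have f: "?f (h, j) = (if h = 0 \<and> j = 0 then Y (Y u n m v) q p w else \<zero>)" for h j
    using assms by (simp add: delta Y_closed smult_zero_complex smult_one_complex)
  have "supp_sum V ?f = Y (Y u n m v) q p w"
  proof (cases "Y (Y u n m v) q p w = \<zero>")
    case True
    then have "{k. ?f k \<noteq> \<zero>} = {}"
      using f by auto
    then show ?thesis
      unfolding supp_sum_def using True by simp
  next
    case False
    then have "{k. ?f k \<noteq> \<zero>} = {(0, 0)}"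
      using f by (auto split: if_splits)
    then show ?thesis
      unfolding supp_sum_def using f[of 0 0] assms by (simp add: Y_closed)
  qed
  \<comment> \<open>These are the mode indices of \<open>jacobi\<close> at a = -n - 1, b = -1 and c
    = -q - 1.\<close>
  moreover have "- (- 1 - i) - 1 = i" "- (- q - 1 - i) - 1 = q + i" "- (- n - 1 - i) - 1 = n + i" for i
    by simp_all
  ultimately show ?thesis
    using jacobi[OF assms, of "- n - 1" "- 1" m "- q - 1" p] by (simp only:)
qed

text \<open>On both sides \<open>iterate_formula\<close> leaves modes of the two given vectors,
  which \<tau> passes one after the other; hence the hypotheses on u and v for every w. Injectivity
  lets \<tau> pass the sums over supports.\<close>

lemma hom_closed_under_modes:
  assumes \<tau>: "linear_endo V \<tau>" "inj_on \<tau> (carrier V)"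
    and uv: "u \<in> carrier V" "v \<in> carrier V" "w \<in> carrier V"
    and u: "\<And>w m0 m. w \<in> carrier V \<Longrightarrow> \<tau> (Y u m0 m w) = Y (\<tau> u) m0 m (\<tau> w)"
    and v: "\<And>w m0 m. w \<in> carrier V \<Longrightarrow> \<tau> (Y v m0 m w) = Y (\<tau> v) m0 m (\<tau> w)"
  shows "\<tau> (Y (Y u n m v) q p w) = Y (\<tau> (Y u n m v)) q p (\<tau> w)"
proof -
  note \<tau>_closed = linear_endoD(1)[OF \<tau>(1)]
  let ?g1 = "\<lambda>(i, j). delta_xy (- n - 1) i j \<odot> Y u i m (Y v (q + j) (p - m) w)"
  let ?g2 = "\<lambda>(i, j). delta_yx (- n - 1) i j \<odot> Y v (q + j) (p - m) (Y u i m w)"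
  let ?h1 = "\<lambda>(i, j). delta_xy (- n - 1) i j \<odot> Y (\<tau> u) i m (Y (\<tau> v) (q + j) (p - m) (\<tau> w))"
  let ?h2 = "\<lambda>(i, j). delta_yx (- n - 1) i j \<odot> Y (\<tau> v) (q + j) (p - m) (Y (\<tau> u) i m (\<tau> w))"
  have closed: "?g1 k \<in> carrier V" "?g2 k \<in> carrier V" for k
    using uv by (cases k; simp add: Y_closed)+
  have "\<tau> (?g1 k) = ?h1 k" "\<tau> (?g2 k) = ?h2 k" for k
    using uv by (cases k; simp add: Y_closed u v linear_endoD(3)[OF \<tau>(1)])+
  then have "supp_sum V (\<lambda>k. \<tau> (?g1 k)) = supp_sum V ?h1" "supp_sum V (\<lambda>k. \<tau> (?g2 k)) = supp_sum V ?h2"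
    by simp_all
  then have "\<tau> (supp_sum V ?g1 \<ominus> supp_sum V ?g2) = supp_sum V ?h1 \<ominus> supp_sum V ?h2"
    by (simp only: linear_endo_minus[OF \<tau>(1)] supp_sum_closed closed linear_endo_supp_sum[OF \<tau>])
  then show ?thesis
    unfolding iterate_formula[OF uv] u[OF uv(2)]
      iterate_formula[OF \<tau>_closed[OF uv(1)] \<tau>_closed[OF uv(2)] \<tau>_closed[OF uv(3)]] .
qed

end

section \<open>The twisted toroidal Lie algebra\<close>

lemma lookup_map_zero: "h 0 = 0 \<Longrightarrow> Poly_Mapping.lookup (Poly_Mapping.map h f) k = h (Poly_Mapping.lookup f k)"
  by (simp add: Poly_Mapping.map.rep_eq when_def)

lemma vector_space_tor_scale:
  assumes "vector_space sc"
  shows "vector_space (tor_scale sc)"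
proof -
  interpret vector_space sc by fact
  show ?thesis
    by unfold_locales
      (auto simp: tor_scale_def lookup_map_zero lookup_add algebra_simps scale_right_distrib
        scale_left_distrib intro!: poly_mapping_eqI prod_eqI)
qed

definition tor_map :: "('g \<Rightarrow> 'g) \<Rightarrow> ('g::ab_group_add, 'r::finite) toroidal \<Rightarrow> ('g, 'r) toroidal" where
  "tor_map h x = (Poly_Mapping.map h (fst x), snd x)"

definition gC_map :: "('g \<Rightarrow> 'g) \<Rightarrow> 'g \<times> complex \<Rightarrow> 'g \<times> complex" where
  "gC_map h m = (h (fst m), snd m)"

locale additive_bij =
  fixes h :: "'g::ab_group_add \<Rightarrow> 'g"
  assumes bij_h: "bij h" and h_add: "h (a + b) = h a + h b"
begin

lemma h_zero [simp]: "h 0 = 0"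
  using h_add[of 0 0] by simp

lemma h_eq_zero [simp]: "h a = 0 \<longleftrightarrow> a = 0"
  using bij_is_inj[OF bij_h] h_zero by (metis injD)

lemma tor_map_simps:
  "tor_map h (x + y) = tor_map h x + tor_map h y" "tor_map h 0 = 0"
  "Poly_Mapping.keys (fst (tor_map h x)) = Poly_Mapping.keys (fst x)"
  "Poly_Mapping.lookup (fst (tor_map h x)) k = h (Poly_Mapping.lookup (fst x) k)"
  "snd (tor_map h x) = snd x"
  "tor_map h (Poly_Mapping.single k a, z) = (Poly_Mapping.single k (h a), z)"
  by (auto simp: tor_map_def lookup_map_zero lookup_add lookup_single when_def h_add in_keys_iff
      intro!: prod_eqI poly_mapping_eqI)

lemma tor_map_sum: "tor_map h (sum f A) = (\<Sum>x\<in>A. tor_map h (f x))"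
  by (induction A rule: infinite_finite_induct) (auto simp: tor_map_simps)

lemma gC_map_add: "gC_map h (m + m') = gC_map h m + gC_map h m'"
  by (simp add: gC_map_def h_add prod_eq_iff)

lemma gC_map_sum: "gC_map h (sum f A) = (\<Sum>x\<in>A. gC_map h (f x))"
  by (induction A rule: infinite_finite_induct) (auto simp: gC_map_add, auto simp: gC_map_def zero_prod_def)

lemma bij_tor_map: "bij (tor_map h :: ('g, 'r::finite) toroidal \<Rightarrow> _)"
proof (rule o_bij)
  have inv: "finv h 0 = 0"
    using inv_f_f[OF bij_is_inj[OF bij_h], of 0] by simp
  show "tor_map (finv h) \<circ> tor_map h = id" "tor_map h \<circ> tor_map (finv h) = id"
    by (auto simp: tor_map_def fun_eq_iff lookup_map_zero inv surj_f_inv_f[OF bij_is_surj[OF bij_h]]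
        inv_f_f[OF bij_is_inj[OF bij_h]] intro!: poly_mapping_eqI)
qed

lemma bij_gC_map: "bij (gC_map h)"
proof (rule o_bij)
  show "gC_map (finv h) \<circ> gC_map h = id" "gC_map h \<circ> gC_map (finv h) = id"
    by (auto simp: gC_map_def fun_eq_iff surj_f_inv_f[OF bij_is_surj[OF bij_h]]
        inv_f_f[OF bij_is_inj[OF bij_h]])
qed

text \<open>As h has trivial kernel, both brackets run over the same keys; the central term is kept
  by the invariance of the form.\<close>

lemma tor_map_br:
  assumes "\<And>a b. h (br a b) = br (h a) (h b)" "\<And>a b. form (h a) (h b) = form a b"
  shows "tor_map h (tor_br br form x y) = tor_br br form (tor_map h x) (tor_map h y)"
  by (simp add: tor_br_def Let_def tor_map_sum tor_map_simps assms cong: if_cong)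

lemma gC_map_act:
  assumes "\<And>a b. h (br a b) = br (h a) (h b)" "\<And>a b. form (h a) (h b) = form a b"
    and "\<And>c a. h (sc c a) = sc c (h a)"
  shows "gC_map h (gC_act sc br form l x m) = gC_act sc br form l (tor_map h x) (gC_map h m)"
proof -
  have "gC_map h (gC_act sc br form l x (b, z)) = gC_act sc br form l (tor_map h x) (gC_map h (b, z))" for b z
    unfolding gC_act_def gC_map_add case_prod_conv
    by (auto simp: gC_map_sum gC_map_def[of h "(_, _)"] gC_scale_def tor_map_simps Let_def assms
        intro!: sum.cong)
  then show ?thesis by (cases m) simp
qed

end

section \<open>The twisted grading and the action of the automorphisms\<close>

locale twisted_toroidal = vector_space sc
  for sc :: "complex \<Rightarrow> 'g::ab_group_add \<Rightarrow> 'g" +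
  fixes br :: "'g \<Rightarrow> 'g \<Rightarrow> 'g"
    and form :: "'g \<Rightarrow> 'g \<Rightarrow> complex"
    and \<sigma> :: "'r::finite option \<Rightarrow> 'g \<Rightarrow> 'g"
    and N :: "'r option \<Rightarrow> nat"
    and l :: complex
  assumes br_linear: "Vector_Spaces.linear sc sc (br a)" "Vector_Spaces.linear sc sc (\<lambda>a. br a b)"
    and linear_\<sigma>: "Vector_Spaces.linear sc sc (\<sigma> i)"
    and bij_\<sigma>: "bij (\<sigma> i)"
    and \<sigma>_br: "\<sigma> i (br a b) = br (\<sigma> i a) (\<sigma> i b)"
    and \<sigma>_form: "form (\<sigma> i a) (\<sigma> i b) = form a b"
    and \<sigma>_commute: "\<sigma> i \<circ> \<sigma> j = \<sigma> j \<circ> \<sigma> i"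
    and \<sigma>_order: "\<sigma> i ^^ N i = id" "0 < N i"
begin

lemma \<sigma>_scale: "\<sigma> i (sc c a) = sc c (\<sigma> i a)"
proof -
  interpret Vector_Spaces.linear sc sc "\<sigma> i" by (rule linear_\<sigma>)
  show ?thesis by (rule scale)
qed

lemma \<sigma>_additive: "additive_bij (\<sigma> i)"
proof -
  interpret Vector_Spaces.linear sc sc "\<sigma> i" by (rule linear_\<sigma>)
  show ?thesis by unfold_locales (auto simp: bij_\<sigma> add)
qed

abbreviation "\<LL> \<equiv> LL sc \<sigma> N"
abbreviation "grade \<equiv> grade_space sc \<sigma> N"

lemma subspace_grade: "subspace (grade m)"
proof (rule subspaceI)
  show "0 \<in> grade m"
    using additive_bij.h_zero[OF \<sigma>_additive] by (simp add: grade_space_def)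
  show "a + b \<in> grade m" if "a \<in> grade m" "b \<in> grade m" for a b
    using that additive_bij.h_add[OF \<sigma>_additive] by (simp add: grade_space_def scale_right_distrib)
  show "sc c a \<in> grade m" if "a \<in> grade m" for c a
    using that by (simp add: grade_space_def \<sigma>_scale mult.commute)
qed

lemma grade_br:
  assumes "a \<in> grade m" "b \<in> grade n"
  shows "br a b \<in> grade (m + n)"
proof -
  have br: "br (sc c a) (sc d b) = sc (c * d) (br a b)" for c d
    using module_hom.scale[OF Vector_Spaces.linear.axioms(3)[OF br_linear(1)]]
      module_hom.scale[OF Vector_Spaces.linear.axioms(3)[OF br_linear(2)]] by simp
  show ?thesis
    using assms by (auto simp: grade_space_def \<sigma>_br br power_int_add)
qed

text \<open>Commuting operators preserve each other's eigenspaces, and injectivity gives the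
  converse. This covers the index \<open>None\<close>, whose automorphism does not enter the
  grading.\<close>

lemma \<sigma>_grade_iff: "\<sigma> i a \<in> grade m \<longleftrightarrow> a \<in> grade m"
proof -
  have "\<sigma> j (\<sigma> i a) = sc c (\<sigma> i a) \<longleftrightarrow> \<sigma> j a = sc c a" for j c
  proof -
    have "\<sigma> j (\<sigma> i a) = \<sigma> i (\<sigma> j a)"
      using \<sigma>_commute[of i j] by (simp add: fun_eq_iff)
    then show ?thesis
      using inj_eq[OF bij_is_inj[OF bij_\<sigma>], of i "\<sigma> j a" "sc c a"] by (simp add: \<sigma>_scale)
  qed
  then show ?thesis
    by (simp add: grade_space_def)
qed

lemma span_grade: "a \<in> span (\<Union>m. grade m)"
proof -
  define \<omega> :: "'r option \<Rightarrow> complex" where "\<omega> i = exp (2 * of_real pi * \<i> / of_nat (N i))" for i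
  \<comment> \<open>The grading is by eigenvalues of the automorphisms with index in
    \<open>range Some\<close>; these have finite order and commute.\<close>
  have "a \<in> span {x. \<forall>i\<in>range Some. \<exists>k. \<sigma> i x = sc (\<omega> i ^ k) x}"
    using primitive_root_of_unity[OF \<sigma>_order(2)]
    by (intro span_simultaneous_eigen[where N = N])
      (auto simp: linear_\<sigma> \<sigma>_order \<sigma>_commute \<omega>_def)
  also have "\<dots> \<subseteq> span (\<Union>m. grade m)"
  proof (rule span_mono, rule subsetI)
    fix x assume "x \<in> {x. \<forall>i\<in>range Some. \<exists>k. \<sigma> i x = sc (\<omega> i ^ k) x}"
    then have "\<forall>i. \<exists>k. \<sigma> (Some i) x = sc (\<omega> (Some i) ^ k) x"
      by auto
    then obtain k where "\<sigma> (Some i) x = sc (\<omega> (Some i) ^ k i) x" for i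
      by metis
    \<comment> \<open>The natural exponents of the eigenvalues, read as integers, give the
      degree.\<close>
    then have "x \<in> grade (\<chi> i. int (k i))"
      by (simp add: grade_space_def \<omega>_def)
    then show "x \<in> (\<Union>m. grade m)" by blast
  qed
  finally show ?thesis .
qed

sublocale tor: vector_space "tor_scale sc :: complex \<Rightarrow> ('g, 'r) toroidal \<Rightarrow> _"
  by (rule vector_space_tor_scale) unfold_locales

lemma LL_iff: "x \<in> \<LL> \<longleftrightarrow> (\<forall>m0 m. Poly_Mapping.lookup (fst x) (m0, m) \<in> grade m)"
  by (cases x) (simp add: LL_def)

lemma LL_nonneg_iff:
  "x \<in> LL_nonneg sc \<sigma> N \<longleftrightarrow> x \<in> \<LL> \<and> (\<forall>m0 m. m0 < 0 \<longrightarrow> Poly_Mapping.lookup (fst x) (m0, m) = 0)"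
  by (cases x) (simp add: LL_nonneg_def)

lemma subspace_LL: "tor.subspace \<LL>"
  using subspace_0[OF subspace_grade] subspace_add[OF subspace_grade] subspace_scale[OF subspace_grade]
  by (intro tor.subspaceI) (auto simp: LL_iff lookup_add tor_scale_def lookup_map_zero)

lemma single_in_LL: "a \<in> grade m \<Longrightarrow> (Poly_Mapping.single (m0, m) a, z) \<in> \<LL>"
  using subspace_0[OF subspace_grade] by (auto simp: LL_iff lookup_single when_def)

lemma LL_br: "x \<in> \<LL> \<Longrightarrow> y \<in> \<LL> \<Longrightarrow> tor_br br form x y \<in> \<LL>"
  unfolding tor_br_def Let_def
proof (intro tor.subspace_sum[OF subspace_LL])
  fix p q :: "int \<times> (int ^ 'r)" assume "x \<in> \<LL>" "y \<in> \<LL>"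
  then have "br (Poly_Mapping.lookup (fst x) p) (Poly_Mapping.lookup (fst y) q) \<in> grade (snd p + snd q)"
    by (intro grade_br) (cases p; cases q; simp add: LL_iff)+
  from single_in_LL[OF this, of "fst p + fst q"]
  show "(Poly_Mapping.single (p + q) (br (Poly_Mapping.lookup (fst x) p) (Poly_Mapping.lookup (fst y) q)),
      if p + q = 0 then of_int (fst p) * form (Poly_Mapping.lookup (fst x) p) (Poly_Mapping.lookup (fst y) q)
      else 0) \<in> \<LL>"
    by (simp add: plus_prod_def)
qed

text \<open>Membership in \<open>LL\<close> and \<open>LL_nonneg\<close> is a condition on single
  coefficients that \<open>\<sigma> i\<close> preserves in both directions; surjectivity then makes
  the images equal to these sets. This opens the way to the transport of induced modules.\<close>

lemma induced_iso_\<sigma>: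
  "induced_iso (tor_scale sc) (tor_br br form) \<LL> (LL_nonneg sc \<sigma> N) (gC_scale sc)
     (gC_act sc br form l) (tor_map (\<sigma> i)) (gC_map (\<sigma> i))"
proof -
  interpret h: additive_bij "\<sigma> i" by (rule \<sigma>_additive)
  have L: "tor_map (\<sigma> i) x \<in> \<LL> \<longleftrightarrow> x \<in> \<LL>" for x
    by (simp add: LL_iff h.tor_map_simps \<sigma>_grade_iff)
  then have P: "tor_map (\<sigma> i) x \<in> LL_nonneg sc \<sigma> N \<longleftrightarrow> x \<in> LL_nonneg sc \<sigma> N" for x
    by (simp add: LL_nonneg_iff h.tor_map_simps)
  have onto: "tor_map (\<sigma> i) ` A = A"
    if "\<And>x. tor_map (\<sigma> i) x \<in> A \<longleftrightarrow> x \<in> A" for A :: "('g, 'r) toroidal set"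
  proof
    show "tor_map (\<sigma> i) ` A \<subseteq> A" using that by blast
    show "A \<subseteq> tor_map (\<sigma> i) ` A"
      using that bij_is_surj[OF h.bij_tor_map] by (metis image_eqI subsetI surjD)
  qed
  show ?thesis
  proof (intro induced_iso.intro lie_induced.intro lie_subset.intro tor.vector_space_axioms
      lie_subset_axioms.intro lie_induced_axioms.intro induced_iso_axioms.intro
      subspace_LL LL_br onto L P h.bij_tor_map h.bij_gC_map)
    show "LL_nonneg sc \<sigma> N \<subseteq> \<LL>" by (auto simp: LL_nonneg_def)
    fix x y :: "('g, 'r) toroidal" and c :: complex and m :: "'g \<times> complex"
    show "tor_map (\<sigma> i) (tor_scale sc c x) = tor_scale sc c (tor_map (\<sigma> i) x)"
      by (auto simp: tor_scale_def tor_map_def lookup_map_zero \<sigma>_scale intro!: poly_mapping_eqI)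
    show "tor_map (\<sigma> i) (tor_br br form x y) = tor_br br form (tor_map (\<sigma> i) x) (tor_map (\<sigma> i) y)"
      by (rule h.tor_map_br) (rule \<sigma>_br \<sigma>_form)+
    show "gC_map (\<sigma> i) (gC_act sc br form l x m) = gC_act sc br form l (tor_map (\<sigma> i) x) (gC_map (\<sigma> i) m)"
      by (rule h.gC_map_act) (rule \<sigma>_br \<sigma>_form \<sigma>_scale)+
  qed (auto simp: h.tor_map_simps h.gC_map_add gC_scale_def gC_map_def \<sigma>_scale h.h_add)
qed

sublocale ind: lie_induced "tor_scale sc" "tor_br br form" \<LL> "LL_nonneg sc \<sigma> N" "gC_scale sc"
    "gC_act sc br form l"
  using induced_iso_\<sigma> by (rule induced_iso.axioms(1))

text \<open>The homogeneous monomials become G and the central element (0, 1) becomes C when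
  \<open>V_induct\<close> is applied.\<close>

lemma LL_span:
  "\<LL> \<subseteq> tor.span ({(Poly_Mapping.single (m0, m) a, 0) | m0 m a. a \<in> grade m} \<union> {(0, 1)})"
    (is "_ \<subseteq> tor.span ?G")
proof
  fix x :: "('g, 'r) toroidal" assume x: "x \<in> \<LL>"
  define f where "f = fst x"
  have f: "Poly_Mapping.lookup f (m0, m) \<in> grade m" for m0 m
    using x by (simp add: LL_iff f_def)
  have "(f, 0) \<in> tor.span ?G"
  proof (induction f rule: poly_mapping_add_induct)
    case (single k)
    then show ?case
      using f by (cases k) (blast intro: tor.span_base)
  next
    case (add f g)
    from tor.span_add[OF this] show ?case by simp
  next
    case zero
    show ?case using tor.span_zero by (simp add: zero_prod_def)
  qed
  moreover have "tor_scale sc (snd x) (0, 1) \<in> tor.span ?G"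
    by (intro tor.span_scale tor.span_base) simp
  ultimately have "(f, 0) + tor_scale sc (snd x) (0, 1) \<in> tor.span ?G"
    by (rule tor.span_add)
  moreover have "Poly_Mapping.map (sc (snd x)) (0 :: int \<times> (int ^ 'r) \<Rightarrow>\<^sub>0 'g) = 0"
    by (rule poly_mapping_eqI) (simp add: lookup_map_zero)
  ultimately show "x \<in> tor.span ?G"
    by (simp add: tor_scale_def f_def)
qed

end

section \<open>Generation of the vertex algebra, uniqueness and existence of the extension\<close>

locale VL_structure = twisted_toroidal sc br form \<sigma> N l
  for sc :: "complex \<Rightarrow> 'g::ab_group_add \<Rightarrow> 'g" and br form
    and \<sigma> :: "'r::finite option \<Rightarrow> 'g \<Rightarrow> 'g" and N l +
  fixes Y
  assumes VL_structure: "is_VL_structure sc br form \<sigma> N l Y"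
begin

abbreviation "VV \<equiv> VL sc br form \<sigma> N l"
abbreviation "inc \<equiv> VL_inc sc br form \<sigma> N l"
abbreviation "vac \<equiv> VL_vac sc br form \<sigma> N l"

lemmas VL_defs = VL_def VL_inc_def VL_vac_def VL_emb_def VL_act_def

sublocale tva: toroidal_vertex_algebra VV Y vac
  using VL_structure by (simp add: is_VL_structure_def)

lemma Y_inc: "a \<in> grade k \<Longrightarrow> v \<in> carrier VV \<Longrightarrow>
    Y (inc a) m0 m v = VL_act sc br form \<sigma> N l (current_coeff N k a m0 m) v"
  using VL_structure by (simp add: is_VL_structure_def)

lemma inc_carrier: "inc a \<in> carrier VV"
  unfolding VL_defs by (rule ind.emb_carrier)

lemma inc_add: "inc (a + b) = inc a \<oplus>\<^bsub>VV\<^esub> inc b"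
  using ind.emb_add[of "(a, 0)" "(b, 0)"] by (simp add: VL_defs)

lemma inc_scale: "inc (sc c a) = c \<odot>\<^bsub>VV\<^esub> inc a"
  using ind.emb_scale[of c "(a, 0)"] by (simp add: VL_defs gC_scale_def)

text \<open>This is \<open>V_induct\<close> in terms of modes: each homogeneous monomial acts on V
  as a mode of an element of \<gg>, and the central element is absorbed into C.\<close>

lemma VL_induct [consumes 0, case_names subset add scale vac inc mode]:
  assumes T: "T \<subseteq> carrier VV"
    and add: "\<And>v w. v \<in> T \<Longrightarrow> w \<in> T \<Longrightarrow> v \<oplus>\<^bsub>VV\<^esub> w \<in> T"
    and scale: "\<And>c v. v \<in> T \<Longrightarrow> c \<odot>\<^bsub>VV\<^esub> v \<in> T"
    and vac: "vac \<in> T"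
    and inc: "\<And>a k. a \<in> grade k \<Longrightarrow> inc a \<in> T"
    and mode: "\<And>a k m0 m v. a \<in> grade k \<Longrightarrow> v \<in> T \<Longrightarrow> Y (inc a) m0 m v \<in> T"
  shows "T = carrier VV"
proof -
  \<comment> \<open>The homogeneous elements span \<gg>, and T is closed under linear
    combinations.\<close>
  have inc_T: "inc a \<in> T" for a
  proof -
    have "subspace {a. inc a \<in> T}"
    proof (rule subspaceI)
      show "0 \<in> {a. inc a \<in> T}"
        using inc[OF subspace_0[OF subspace_grade[of 0]]] by simp
    qed (auto simp: inc_add inc_scale add scale)
    then have "span (\<Union>k. grade k) \<subseteq> {a. inc a \<in> T}"
      using inc by (intro span_minimal) auto
    then show ?thesis using span_grade by blast
  qed
  have "carrier ind.V = T"
  proof (rule ind.V_induct[OF _ _ _ _ LL_span])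
    show "T \<subseteq> carrier ind.V"
      using T by (simp add: VL_def)
    show "v \<oplus>\<^bsub>ind.V\<^esub> w \<in> T" if "v \<in> T" "w \<in> T" for v w
      using add[OF that] by (simp add: VL_def)
    show "c \<odot>\<^bsub>ind.V\<^esub> v \<in> T" if "v \<in> T" for c v
      using scale[OF that] by (simp add: VL_def)
    show "ind.emb m \<in> T" for m
    proof -
      \<comment> \<open>An embedded vector is an element of \<gg> plus a multiple of the
        vacuum.\<close>
      have "m = (fst m, 0) + gC_scale sc (snd m) (0, 1)"
        by (simp add: gC_scale_def)
      then have "ind.emb m = inc (fst m) \<oplus>\<^bsub>VV\<^esub> (snd m \<odot>\<^bsub>VV\<^esub> vac)"
        using ind.emb_add[of "(fst m, 0)" "gC_scale sc (snd m) (0, 1)"] ind.emb_scale[of "snd m" "(0, 1)"]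
        by (simp add: VL_defs)
      then show ?thesis
        using add[OF inc_T scale[OF vac]] by simp
    qed
    show "{(Poly_Mapping.single (m0, m) a, 0) | m0 m a. a \<in> grade m} \<subseteq> \<LL>"
      using single_in_LL by blast
    show "ind.act x v \<in> T"
      if x: "x \<in> {(Poly_Mapping.single (m0, m) a, 0) | m0 m a. a \<in> grade m}" and v: "v \<in> T" for x v
    proof -
      obtain m0 m a where a: "a \<in> grade m" "x = (Poly_Mapping.single (m0, m) a, 0)"
        using x by blast
      \<comment> \<open>With the degree m of a itself as base point the divisibility condition is
        trivial, so the monomial x is a coefficient of the generating function of a and acts as a
        mode.\<close>
      have "current_coeff N m a m0 m = x"
        by (simp add: current_coeff_def a(2))
      then show ?thesis
        using Y_inc[OF a(1), of v m0 m] mode[OF a(1) v, of m0 m] v T by (auto simp: VL_act_def)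
    qed
    show "{(0, 1)} \<subseteq> LL_nonneg sc \<sigma> N"
      using subspace_0[OF subspace_grade] by (auto simp: LL_nonneg_iff LL_iff)
    show "tor_br br form z x = 0" if "z \<in> {(0, 1)}" for z x
      using that by (simp add: tor_br_def)
  qed
  then show ?thesis by (simp add: VL_def)
qed

abbreviation "is_aut \<equiv> toroidal_va_automorphism VV Y vac"

text \<open>The vectors on which the two maps agree contain the generators and are closed under
  modes of homogeneous elements. Off the carrier both take the default value of extensional
  functions.\<close>

lemma automorphism_unique:
  assumes "is_aut \<tau>" "is_aut \<tau>'" "\<And>a. \<tau> (inc a) = \<tau>' (inc a)"
  shows "\<tau> = \<tau>'"
proof -
  have \<tau>: "linear_endo VV \<tau>" "linear_endo VV \<tau>'" "\<tau> vac = vac" "\<tau>' vac = vac"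
    and ext: "\<tau> \<in> extensional (carrier VV)" "\<tau>' \<in> extensional (carrier VV)"
    and Y: "\<And>u v m0 m. u \<in> carrier VV \<Longrightarrow> v \<in> carrier VV \<Longrightarrow> \<tau> (Y u m0 m v) = Y (\<tau> u) m0 m (\<tau> v)"
      "\<And>u v m0 m. u \<in> carrier VV \<Longrightarrow> v \<in> carrier VV \<Longrightarrow> \<tau>' (Y u m0 m v) = Y (\<tau>' u) m0 m (\<tau>' v)"
    using assms(1,2) by (simp_all add: toroidal_va_automorphism_def Bij_def)
  have "{v \<in> carrier VV. \<tau> v = \<tau>' v} = carrier VV"
  proof (rule VL_induct)
    fix a k m0 m v assume "v \<in> {v \<in> carrier VV. \<tau> v = \<tau>' v}"
    then show "Y (inc a) m0 m v \<in> {v \<in> carrier VV. \<tau> v = \<tau>' v}"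
      by (simp add: Y inc_carrier tva.Y_closed assms(3))
  qed (auto simp: linear_endoD[OF \<tau>(1)] linear_endoD[OF \<tau>(2)] \<tau>(3,4) tva.vac_closed inc_carrier assms(3)
      tva.smult_carrier)
  then show ?thesis
    by (intro extensionalityI[OF ext]) blast
qed

text \<open>On the generators the mode equation says that \<open>\<tau>\<close> intertwines the action of \<open>\<LL>\<close>; the Jacobi
  identity extends it to all of \<open>V\<close>.\<close>

lemma automorphism_exists: "\<exists>\<tau>. is_aut \<tau> \<and> (\<forall>a. \<tau> (inc a) = inc (\<sigma> i a))"
proof -
  interpret iso: induced_iso "tor_scale sc" "tor_br br form" \<LL> "LL_nonneg sc \<sigma> N" "gC_scale sc"
    "gC_act sc br form l" "tor_map (\<sigma> i)" "gC_map (\<sigma> i)"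
    by (rule induced_iso_\<sigma>)
  \<comment> \<open>The restriction makes the map extensional, as \<open>Bij\<close>
    demands.\<close>
  define \<tau> where "\<tau> = restrict ((`) iso.tensor_map) (carrier VV)"
  have \<tau>_eq: "\<tau> v = iso.tensor_map ` v" if "v \<in> carrier VV" for v
    using that by (simp add: \<tau>_def)
  have bij: "bij_betw \<tau> (carrier VV) (carrier VV)"
    using iso.bij_betw_carrier \<tau>_eq unfolding VL_def by (simp cong: bij_betw_cong)
  then have Bij: "\<tau> \<in> Bij (carrier VV)"
    by (simp add: Bij_def \<tau>_def)
  have closed: "\<tau> v \<in> carrier VV" if "v \<in> carrier VV" for v
    using bij that by (rule bij_betwE[THEN bspec])
  have lin: "linear_endo VV \<tau>"
    unfolding linear_endo_def
  proof (intro conjI ballI allI Pi_I closed)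
    show "\<tau> (v \<oplus>\<^bsub>VV\<^esub> w) = \<tau> v \<oplus>\<^bsub>VV\<^esub> \<tau> w" if "v \<in> carrier VV" "w \<in> carrier VV" for v w
      using that iso.image_add[of v w] by (simp add: \<tau>_eq VL_def[symmetric])
    show "\<tau> (c \<odot>\<^bsub>VV\<^esub> v) = c \<odot>\<^bsub>VV\<^esub> \<tau> v" if "v \<in> carrier VV" for c v
      using that iso.image_smult[of c v] by (simp add: \<tau>_eq VL_def[symmetric] tva.smult_carrier)
  qed
  have vac: "\<tau> vac = vac"
    using iso.image_emb[of "(0, 1)"] \<tau>_eq[OF tva.vac_closed] additive_bij.h_zero[OF \<sigma>_additive]
    by (simp add: VL_defs gC_map_def)
  have inc: "\<tau> (inc a) = inc (\<sigma> i a)" for a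
    using iso.image_emb[of "(a, 0)"] \<tau>_eq[OF inc_carrier, of a]
    by (simp add: VL_defs gC_map_def)
  have Y_inc_hom: "\<tau> (Y (inc a) m0 m w) = Y (\<tau> (inc a)) m0 m (\<tau> w)"
    if "a \<in> grade k" "w \<in> carrier VV" for a k m0 m w
  proof -
    have "\<tau> (Y (inc a) m0 m w) = iso.tensor_map ` Y (inc a) m0 m w"
      by (rule \<tau>_eq[OF tva.Y_closed[OF inc_carrier that(2)]])
    also have "\<dots> = iso.tensor_map ` ind.act (current_coeff N k a m0 m) w"
      unfolding Y_inc[OF that] VL_act_def by (rule refl)
    also have "\<dots> = ind.act (tor_map (\<sigma> i) (current_coeff N k a m0 m)) (\<tau> w)"
      by (simp add: iso.image_act \<tau>_eq that(2))
    also have "tor_map (\<sigma> i) (current_coeff N k a m0 m) = current_coeff N k (\<sigma> i a) m0 m"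
      by (simp add: current_coeff_def additive_bij.tor_map_simps(2,6)[OF \<sigma>_additive]
          zero_prod_def[symmetric])
    \<comment> \<open>As \<open>\<sigma> i\<close> preserves degrees, \<open>\<sigma> i a\<close>
      has degree k again and its generating function has the same exponents as that of a.\<close>
    also have "ind.act \<dots> (\<tau> w) = Y (inc (\<sigma> i a)) m0 m (\<tau> w)"
      using Y_inc[of "\<sigma> i a" k "\<tau> w" m0 m] that closed \<sigma>_grade_iff by (simp add: VL_act_def)
    finally show ?thesis by (simp add: inc)
  qed
  let ?T = "{u \<in> carrier VV. \<forall>w\<in>carrier VV. \<forall>m0 m. \<tau> (Y u m0 m w) = Y (\<tau> u) m0 m (\<tau> w)}"
  have "?T = carrier VV"
  proof (rule VL_induct)
    show "u \<oplus>\<^bsub>VV\<^esub> v \<in> ?T" if "u \<in> ?T" "v \<in> ?T" for u v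
      using that by (auto simp: linear_endoD[OF tva.linear_left] linear_endoD[OF lin] closed tva.Y_closed)
    show "c \<odot>\<^bsub>VV\<^esub> u \<in> ?T" if "u \<in> ?T" for c u
      using that by (auto simp: linear_endoD[OF tva.linear_left] linear_endoD[OF lin] closed tva.Y_closed
          tva.smult_carrier)
    show "vac \<in> ?T"
      using tva.linear_endo_zero[OF lin] by (auto simp: tva.vac_closed tva.vacuum vac closed)
    show "inc a \<in> ?T" if "a \<in> grade k" for a k
      using Y_inc_hom[OF that] inc_carrier by blast
    show "Y (inc a) n m v \<in> ?T" if a: "a \<in> grade k" and v: "v \<in> ?T" for a k n m v
    proof -
      have "\<tau> (Y (Y (inc a) n m v) q p w) = Y (\<tau> (Y (inc a) n m v)) q p (\<tau> w)"
        if "w \<in> carrier VV" for q p w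
        using v that Y_inc_hom[OF a]
        by (intro tva.hom_closed_under_modes lin bij_betw_imp_inj_on[OF bij] inc_carrier) auto
      then show ?thesis
        using v by (auto simp: tva.Y_closed inc_carrier)
    qed
  qed blast
  then have "is_aut \<tau>"
    using Bij lin vac unfolding toroidal_va_automorphism_def by blast
  then show ?thesis
    using inc by blast
qed

end

theorem lemma4p6:
  fixes sc :: "complex \<Rightarrow> 'g::ab_group_add \<Rightarrow> 'g"
    and br :: "'g \<Rightarrow> 'g \<Rightarrow> 'g"
    and form :: "'g \<Rightarrow> 'g \<Rightarrow> complex"
    and \<sigma> :: "'r::finite option \<Rightarrow> 'g \<Rightarrow> 'g"
    and N :: "'r option \<Rightarrow> nat"
    and l :: complex
    and Y :: "(('g, 'r) toroidal, 'g \<times> complex) pre_tensor set \<Rightarrow> int \<Rightarrow> int ^ 'r \<Rightarrow>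
      (('g, 'r) toroidal, 'g \<times> complex) pre_tensor set \<Rightarrow>
      (('g, 'r) toroidal, 'g \<times> complex) pre_tensor set"
  assumes simple: "fd_simple_lie_algebra sc br"
    and form: "normalized_killing_form sc br form"
    and aut: "\<And>i. lie_automorphism sc br (\<sigma> i)"
    and commute: "\<And>i j. \<sigma> i \<circ> \<sigma> j = \<sigma> j \<circ> \<sigma> i"
    and order: "\<And>i. has_order (\<sigma> i) (N i)"
    and structure_Y: "is_VL_structure sc br form \<sigma> N l Y"
  shows "\<forall>i. \<exists>!\<tau>.
    toroidal_va_automorphism (VL sc br form \<sigma> N l) Y (VL_vac sc br form \<sigma> N l) \<tau> \<and>
    (\<forall>a. \<tau> (VL_inc sc br form \<sigma> N l a) = VL_inc sc br form \<sigma> N l (\<sigma> i a))"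
proof
  fix i
  interpret L: fd_simple_lie_algebra sc br by (rule simple)
  \<comment> \<open>Invariance of the form reduces to that of the Killing form, of which it is a
    multiple.\<close>
  obtain c where c: "\<And>x y. form x y = c * killing_form sc br x y"
    using form unfolding normalized_killing_form_def by blast
  interpret VL_structure sc br form \<sigma> N l Y
  proof (intro VL_structure.intro twisted_toroidal.intro twisted_toroidal_axioms.intro
      VL_structure_axioms.intro L.vector_space_axioms)
    show "form (\<sigma> i a) (\<sigma> i b) = form a b" for i a b
      by (simp add: c killing_form_invariant[OF simple aut])
  qed (use aut commute order structure_Y L.br_linear_left L.br_linear_right in
      \<open>simp_all add: lie_automorphism_def has_order_def\<close>)
  obtain \<tau> where \<tau>: "is_aut \<tau>" "\<And>a. \<tau> (inc a) = inc (\<sigma> i a)"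
    using automorphism_exists[of i] by blast
  show "\<exists>!\<tau>. is_aut \<tau> \<and> (\<forall>a. \<tau> (inc a) = inc (\<sigma> i a))"
  proof (rule ex1I[of _ \<tau>])
    show "\<tau>' = \<tau>" if "is_aut \<tau>' \<and> (\<forall>a. \<tau>' (inc a) = inc (\<sigma> i a))" for \<tau>'
      using that \<tau> by (intro automorphism_unique) simp_all
  qed (use \<tau> in blast)
qed

end
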